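(* Consider an agent $i$ that at each time step $j=1,2,\ldots$ observes a pair $(x_{i,j},y_{i,j})$ generated by $y_{i,j}=\Theta x_{i,j}+\eta_{i,j}$, where $\Theta\in\mathbb{R}^{l\times n}$ is unknown, and $x_{i,j}\sim\mathcal{N}(\mu_{i,j},\sigma_x^2I_n)$, $\eta_{i,j}\sim\mathcal{N}(0,\sigma_\eta^2I_l)$ are Gaussian random vectors, all mutually independent over time, with deterministic means satisfying $\|\mu_{i,j}\|\le\hat{\mu}$ for all $j$ (here $\sigma_x>0$, $\sigma_\eta>0$, $\hat\mu\ge0$). Let $\hat{\Theta}_{i,t+1}=\big(\sum_{j=1}^t y_{i,j}x_{i,j}^*\big)\big(\sum_{j=1}^t x_{i,j}x_{i,j}^*\big)^{\dagger}$ be the local least-squares estimate. Fix $\delta>0$ and let $t\ge\max(t_1,t_2,t_3)$, where $t_1=8n+16\log\frac{2}{\delta}$, $t_2=\left(\frac{16\hat{\mu}(\sqrt{4n}+\sqrt{2\log\frac{2}{\delta}})}{\sigma_x}\right)^2$, $t_3=2(n+l)\log\frac{1}{\delta}$. Let $\bar{\mu}_{i,t}=\frac{4}{t\sigma_x^2}\sum_{j=1}^t\mu_{i,j}\mu_{i,j}^*$. Then with probability at least $1-4\delta$, $$\|\hat{\Theta}_{i,t+1}-\Theta\|\le\frac{C_1}{\sqrt{t}\,\sigma_x^2\,\lambda_{\min}(I_n+\bar{\mu}_{i,t})},$$ where $C_1=8\sigma_\eta\left(4\sigma_x\sqrt{(n+l)\log\frac{9}{\delta}}+\hat{\mu}\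big(\sqrt{2(l+n)}+2\sqrt{\log\frac{2}{\delta}}\big)\right)$.
   Context: $\|\cdot\|$ denotes the spectral norm, $A^*$ the (conjugate) transpose, $A^\dagger$ the pseudoinverse (equal to the inverse when $A$ is invertible), and $\lambda_{\min}$ the smallest eigenvalue (in magnitude). *)

theory Defs
  imports "HOL-Analysis.Analysis" "HOL-Probability.Probability"
begin

definition spec_norm :: "real^'n^'m \<Rightarrow> real" where
  "spec_norm A = onorm (\<lambda>v. A *v v)"

definition outer :: "real^'l \<Rightarrow> real^'n \<Rightarrow> real^'n^'l" where
  "outer u v = (\<chi> a b. u $ a * v $ b)"

definition pinv :: "real^'n^'m \<Rightarrow> real^'m^'n" where
  "pinv A = (THE B. A ** B ** A = A \<and> B ** A ** B = B \<and>
                    transpose (A ** B) = A ** B \<and> transpose (B ** A) = B ** A)"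

definition lambda_min :: "real^'n^'n \<Rightarrow> real" where
  "lambda_min A = (ARG_MIN abs c. (\<exists>v. v \<noteq> 0 \<and> A *v v = c *\<^sub>R v))"

end

theory Submission
  imports Defs
begin

text \<open>
  On the event that the Gram matrix \<open>V = \<Sum> x x\<^sup>T\<close> satisfies \<open>z\<^sup>T V z \<ge> \<Lambda> |z|\<^sup>2\<close>, the error at \<open>u\<close> is
  \<open>\<Sum> (x \<bullet> z) \<eta>\<close> with \<open>z = V\<^sup>-\<^sup>1 u\<close>. Conditionally on the design this is Gaussian of size \<open>|V\<^sup>1\<^sup>/\<^sup>2 z|\<close>,
  so the error is at most \<open>g \<sigma>\<^sub>\<eta> / sqrt \<Lambda>\<close>, where \<open>g\<close> bounds an \<open>l \<times> n\<close> standard Gaussian matrix.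
  Extremal singular values are controlled without nets: a bad unit vector spoils a whole small ball, hence a
  fixed proportion of the volume, and the expected spoiled volume is computed from Laplace transforms of
  (noncentral) chi-square variables.

  Two regimes for \<open>r = \<mu>' / \<sigma>\<^sub>x\<close>, with \<open>\<mu>'\<close> the bound on the means, make the constants fit. For \<open>r \<le> 1/2\<close> the
  requirement \<open>t \<ge> t\<^sub>1\<close> only yields \<open>\<Lambda> \<ge> t \<sigma>\<^sub>x\<^sup>2 / 36\<close>, which suffices because the first summand of \<open>C\<^sub>1\<close> is
  generous. For \<open>r \<ge> 1/2\<close> the requirement \<open>t \<ge> t\<^sub>2\<close> makes \<open>t\<close> so large that
  \<open>\<Lambda> \<ge> t \<sigma>\<^sub>x\<^sup>2 (1 + m) / 2\<close> with \<open>m = (\<lambda>\<^sub>m\<^sub>i\<^sub>n - 1) / 4\<close>; moreover \<open>m \<le> r\<^sup>2 / n\<close> because the smallest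
  eigenvalue is at most the average one.
\<close>

subsection \<open>Volume union bound\<close>

text \<open>The ball is the image of the unit ball under scaling by \<open>r\<close> and translation
  by \<open>a\<close>. A general \<open>p\<close> is allowed because the noise is later measured
  against balls of a design seminorm.\<close>

lemma emeasure_ball_of_norm:
  fixes p :: "'a::euclidean_space \<Rightarrow> real"
  assumes hom: "\<And>c v. p (c *\<^sub>R v) = \<bar>c\<bar> * p v"
    and cont: "continuous_on UNIV p" and "r > 0"
  shows "emeasure lborel {v. p (v - a) \<le> r} = ennreal (r ^ DIM('a)) * emeasure lborel {v. p v \<le> 1}"
proof -
  have cl: "closed {v. p (v - a) \<le> r}" for a r
    by (intro closed_Collect_le continuous_on_const continuous_on_compose2[OF cont] continuous_intros) auto
  have "x \<in> (\<lambda>x. r *\<^sub>R x + a) ` {v. p v \<le> 1}" if "p (x - a) \<le> r" for x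
  proof (rule image_eqI)
    show "x = r *\<^sub>R ((1 / r) *\<^sub>R (x - a)) + a"
      using \<open>r > 0\<close> by simp
    show "(1 / r) *\<^sub>R (x - a) \<in> {v. p v \<le> 1}"
      using \<open>r > 0\<close> that by (simp add: hom)
  qed
  then have "{v. p (v - a) \<le> r} = (\<lambda>x. r *\<^sub>R x + a) ` {v. p v \<le> 1}"
    using \<open>r > 0\<close> by (auto simp: hom)
  then have "emeasure lebesgue {v. p (v - a) \<le> r} = \<bar>r\<bar> ^ DIM('a) * emeasure lebesgue {v. p v \<le> 1}"
    by (simp add: emeasure_lebesgue_affine del: emeasure_completion)
  moreover have "{v. p (v - a) \<le> r} \<in> sets lborel" "{v. p v \<le> 1} \<in> sets lborel"
    using cl[of a r] cl[of 0 1] by auto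
  ultimately show ?thesis
    using \<open>r > 0\<close> by simp
qed

text \<open>The lower bound by \<open>k * norm v\<close> makes the unit ball bounded; continuity and
  \<open>p 0 = 0\<close> put a nonempty open set inside it. Both facts allow division by its
  volume.\<close>

lemma unit_ball_of_norm_finite_positive:
  fixes p :: "'a::euclidean_space \<Rightarrow> real"
  assumes p0: "p 0 = 0" and cont: "continuous_on UNIV p"
    and "k > 0" and lower: "\<And>v. k * norm v \<le> p v"
  shows "0 < emeasure lborel {v. p v \<le> 1}" "emeasure lborel {v. p v \<le> 1} < \<infinity>"
proof -
  have "norm v \<le> 1 / k" if "p v \<le> 1" for v
    using lower[of v] that \<open>k > 0\<close> by (simp add: field_simps)
  then show "emeasure lborel {v. p v \<le> 1} < \<infinity>"
    by (intro emeasure_bounded_finite) (auto simp: bounded_iff)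
  have op: "open {v. p v < 1}"
    by (intro open_Collect_less cont continuous_on_const)
  have "closed {v. p v \<le> 1}"
    by (intro closed_Collect_le cont continuous_on_const)
  moreover have "emeasure lborel {v. p v < 1} \<noteq> 0"
  proof
    assume "emeasure lborel {v. p v < 1} = 0"
    then have "negligible {v. p v < 1}"
      using op by (auto simp: negligible_iff_null_sets intro!: null_sets_completionI)
    then show False
      using open_not_negligible[OF op] p0 by (metis empty_Collect_eq zero_less_one)
  qed
  moreover have "emeasure lborel {v. p v < 1} \<le> emeasure lborel {v. p v \<le> 1}"
    using \<open>closed _\<close> by (intro emeasure_mono) auto
  ultimately show "0 < emeasure lborel {v. p v \<le> 1}"
    by (metis bot.extremum_uniqueI bot_ennreal order_less_le zero_le)
qed

text \<open>
  Replaces the union bound over a net: if \<open>Q \<omega>\<close> holds on a whole \<open>e\<close>-ball around some unit vector,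
  then the volume of \<open>{v. Q \<omega> v}\<close> inside the ball of radius \<open>1 + e\<close> is at least that of an \<open>e\<close>-ball,
  and Markov's inequality applies to this volume.
\<close>
lemma (in prob_space) volume_union_bound:
  fixes p :: "'v::euclidean_space \<Rightarrow> real"
  assumes hom: "\<And>c v. p (c *\<^sub>R v) = \<bar>c\<bar> * p v"
    and tri: "\<And>u v. p (u + v) \<le> p u + p v"
    and cont: "continuous_on UNIV p"
    and k: "k > 0" "\<And>v. k * norm v \<le> p v"
    and e: "0 < e" and c: "0 \<le> c"
    and Q[measurable]: "Measurable.pred (M \<Otimes>\<^sub>M borel) (\<lambda>z. Q (fst z) (snd z))"
    and bound: "\<And>v. 1 - e \<le> p v \<Longrightarrow> p v \<le> 1 + e \<Longrightarrow> emeasure M {\<omega>\<in>space M. Q \<omega> v} \<le> ennreal c"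
  shows "\<exists>A\<in>sets M. emeasure M A \<le> ennreal (((1 + e) / e) ^ DIM('v) * c) \<and>
    (\<forall>\<omega>\<in>space M. \<forall>v0. p v0 = 1 \<longrightarrow> (\<forall>v. p (v - v0) \<le> e \<longrightarrow> Q \<omega> v) \<longrightarrow> \<omega> \<in> A)"
proof -
  interpret L: pair_sigma_finite M "lborel :: 'v measure" ..
  have p0: "p 0 = 0" using hom[of 0 0] by simp
  have pm: "p (- v) = p v" for v using hom[of "-1" v] by simp
  have [measurable]: "p \<in> borel_measurable borel"
    by (rule borel_measurable_continuous_onI[OF cont])
  \<comment> \<open>The shell containing every \<open>e\<close>-ball around a \<open>p\<close>-unit
    vector. Pointwise tail bounds are required only there, hence only for vectors of controlled
    size.\<close>
  define E where "E = {v. 1 - e \<le> p v \<and> p v \<le> 1 + e}"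
  have [measurable]: "E \<in> sets borel" unfolding E_def by measurable
  define B where "B = emeasure lborel {v. p v \<le> 1}"
  obtain b where b: "B = ennreal b" "b > 0"
    using unit_ball_of_norm_finite_positive[OF p0 cont k] unfolding B_def[symmetric]
    by (cases B) auto
  have Be: "emeasure lborel {v. p (v - a) \<le> r} = ennreal (r ^ DIM('v) * b)" if "r > 0" for a r
    using emeasure_ball_of_norm[OF hom cont that] b that by (simp add: B_def ennreal_mult')
  define f where "f \<omega> = emeasure lborel {v. v \<in> E \<and> Q \<omega> v}" for \<omega>
  have f_eq: "f \<omega> = (\<integral>\<^sup>+v. indicator {v. v \<in> E \<and> Q \<omega> v} v \<partial>lborel)" if "\<omega> \<in> space M" for \<omega>
  proof -
    have "Measurable.pred borel (Q \<omega>)"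
      using measurable_compose[OF measurable_Pair1'[OF that, of borel] Q] by simp
    then show ?thesis
      unfolding f_def by (subst nn_integral_indicator) auto
  qed
  have ind: "(\<lambda>(\<omega>, v). indicator {v. v \<in> E \<and> Q \<omega> v} v :: ennreal) \<in> borel_measurable (M \<Otimes>\<^sub>M lborel)"
  proof -
    have "(\<lambda>z. if snd z \<in> E \<and> Q (fst z) (snd z) then 1 else 0 :: ennreal) \<in> borel_measurable (M \<Otimes>\<^sub>M borel)"
      by measurable
    then have "(\<lambda>z. if snd z \<in> E \<and> Q (fst z) (snd z) then 1 else 0 :: ennreal) \<in> borel_measurable (M \<Otimes>\<^sub>M lborel)"
      by (simp cong: measurable_cong_sets sets_pair_measure_cong)
    then show ?thesis
      by (rule measurable_cong[THEN iffD1, rotated]) (auto simp: indicator_def)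
  qed
  have fm: "f \<in> borel_measurable M"
    using lborel.borel_measurable_nn_integral_fst[OF ind] 
    by (rule measurable_cong[THEN iffD1, rotated]) (simp add: f_eq)
  have "(\<integral>\<^sup>+\<omega>. f \<omega> \<partial>M) = (\<integral>\<^sup>+\<omega>. (\<integral>\<^sup>+v. indicator {v. v \<in> E \<and> Q \<omega> v} v \<partial>lborel) \<partial>M)"
    by (intro nn_integral_cong) (simp add: f_eq)
  also have "\<dots> = (\<integral>\<^sup>+v. (\<integral>\<^sup>+\<omega>. indicator {v. v \<in> E \<and> Q \<omega> v} v \<partial>M) \<partial>lborel)"
    using L.Fubini'[OF ind] by simp
  \<comment> \<open>After exchanging the integrals, the inner one is the probability that a fixed
    \<open>v\<close> is bad, at most \<open>c\<close> on the shell, and the shell lies in the ball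
    of radius \<open>1 + e\<close>.\<close>
  also have "\<dots> \<le> (\<integral>\<^sup>+v. ennreal c * indicator {v. p (v - 0) \<le> 1 + e} v \<partial>lborel)"
  proof (intro nn_integral_mono)
    fix v :: 'v
    have "Measurable.pred M (\<lambda>\<omega>. Q \<omega> v)"
      using measurable_compose[OF measurable_Pair2'[of v borel M] Q] by simp
    then have "{\<omega>\<in>space M. Q \<omega> v} \<in> sets M" by simp
    moreover have "(\<integral>\<^sup>+\<omega>. indicator {v. v \<in> E \<and> Q \<omega> v} v \<partial>M)
      = (\<integral>\<^sup>+\<omega>. indicator E v * indicator {\<omega>\<in>space M. Q \<omega> v} \<omega> \<partial>M)"
      by (intro nn_integral_cong) (auto simp: indicator_def)
    ultimately have "(\<integral>\<^sup>+\<omega>. indicator {v. v \<in> E \<and> Q \<omega> v} v \<partial>M)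
      = indicator E v * emeasure M {\<omega>\<in>space M. Q \<omega> v}"
      by (simp add: nn_integral_cmult)
    also have "\<dots> \<le> ennreal c * indicator {v. p (v - 0) \<le> 1 + e} v"
      using bound[of v] by (auto simp: indicator_def E_def)
    finally show "(\<integral>\<^sup>+\<omega>. indicator {v. v \<in> E \<and> Q \<omega> v} v \<partial>M) \<le> ennreal c * indicator {v. p (v - 0) \<le> 1 + e} v" .
  qed
  also have "\<dots> = ennreal c * ennreal ((1 + e) ^ DIM('v) * b)"
    using Be[of "1 + e" 0] e by (subst nn_integral_cmult_indicator) auto
  finally have fint: "(\<integral>\<^sup>+\<omega>. f \<omega> \<partial>M) \<le> ennreal (c * ((1 + e) ^ DIM('v) * b))"
    using c by (simp add: ennreal_mult')
  \<comment> \<open>\<open>e ^ DIM('v) * b\<close> is the volume of an \<open>e\<close>-ball, so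
    \<open>A\<close> is the event that at least this much volume is spoiled.\<close>
  define A where "A = {\<omega>\<in>space M. 1 \<le> ennreal (1 / (e ^ DIM('v) * b)) * f \<omega>}"
  have "A \<in> sets M"
    unfolding A_def using fm by measurable
  moreover have "emeasure M A \<le> ennreal (((1 + e) / e) ^ DIM('v) * c)"
  proof -
    have "emeasure M A \<le> ennreal (1 / (e ^ DIM('v) * b)) * (\<integral>\<^sup>+\<omega>. f \<omega> * indicator (space M) \<omega> \<partial>M)"
      unfolding A_def using fm by (intro nn_integral_Markov_inequality) auto
    also have "(\<integral>\<^sup>+\<omega>. f \<omega> * indicator (space M) \<omega> \<partial>M) = (\<integral>\<^sup>+\<omega>. f \<omega> \<partial>M)"
      by (intro nn_integral_cong) auto
    also have "ennreal (1 / (e ^ DIM('v) * b)) * \<dots> \<le> ennreal (1 / (e ^ DIM('v) * b)) * ennreal (c * ((1 + e) ^ DIM('v) * b))"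
      by (intro mult_left_mono fint) simp
    also have "\<dots> = ennreal (((1 + e) / e) ^ DIM('v) * c)"
      using e b c by (simp add: ennreal_mult'[symmetric] field_simps power_divide)
    finally show ?thesis .
  qed
  moreover have "\<omega> \<in> A" if w: "\<omega> \<in> space M" and v0: "p v0 = 1" and Qv: "\<And>v. p (v - v0) \<le> e \<Longrightarrow> Q \<omega> v" for \<omega> v0
  proof -
    have "{v. p (v - v0) \<le> e} \<subseteq> {v. v \<in> E \<and> Q \<omega> v}"
    proof safe
      fix v assume v: "p (v - v0) \<le> e"
      show "Q \<omega> v" by (rule Qv[OF v])
      have "p v \<le> 1 + e" using tri[of "v - v0" v0] v v0 by simp
      moreover have "1 - e \<le> p v" using tri[of "v0 - v" v] pm[of "v - v0"] v v0 by simp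
      ultimately show "v \<in> E" by (simp add: E_def)
    qed
    moreover have "{v. v \<in> E \<and> Q \<omega> v} \<in> sets lborel"
      using measurable_compose[OF measurable_Pair1'[OF w, of borel] Q] by simp
    ultimately have "ennreal (e ^ DIM('v) * b) \<le> f \<omega>"
      unfolding f_def Be[OF e, symmetric, of v0] by (intro emeasure_mono) auto
    then have "ennreal (1 / (e ^ DIM('v) * b)) * ennreal (e ^ DIM('v) * b) \<le> ennreal (1 / (e ^ DIM('v) * b)) * f \<omega>"
      by (intro mult_left_mono) auto
    moreover have "ennreal (1 / (e ^ DIM('v) * b)) * ennreal (e ^ DIM('v) * b) = 1"
      using e b by (simp add: ennreal_mult'[symmetric])
    ultimately show ?thesis
      using w by (simp add: A_def)
  qed
  ultimately show ?thesis by blast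
qed

subsection \<open>Gaussian Laplace transforms\<close>

lemma (in prob_space) nn_integral_exp_square_normal:
  assumes Y: "distributed M lborel Y (normal_density m \<tau>)"
    and "0 < \<tau>" and D: "0 < 1 + 2 * s * \<tau>\<^sup>2"
  shows "(\<integral>\<^sup>+\<omega>. ennreal (exp (- s * (Y \<omega>)\<^sup>2)) \<partial>M)
    = ennreal (exp (- s * m\<^sup>2 / (1 + 2 * s * \<tau>\<^sup>2)) / sqrt (1 + 2 * s * \<tau>\<^sup>2))"
proof -
  define D where "D = 1 + 2 * s * \<tau>\<^sup>2"
  have D0: "D > 0" and s: "s = (D - 1) / (2 * \<tau>\<^sup>2)"
    using D \<open>0 < \<tau>\<close> by (auto simp: D_def)
  have eq: "normal_density m \<tau> y * exp (- s * y\<^sup>2) = exp (- s * m\<^sup>2 / D) / sqrt D * normal_density (m / D) (\<tau> / sqrt D) y" for y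
  proof -
    have "- (y - m)\<^sup>2 / (2 * \<tau>\<^sup>2) + (- s * y\<^sup>2) = - s * m\<^sup>2 / D + - (y - m / D)\<^sup>2 / (2 * (\<tau> / sqrt D)\<^sup>2)"
      unfolding s using D0 \<open>0 < \<tau>\<close> by (simp add: power_divide divide_simps) (simp add: power2_eq_square algebra_simps)
    moreover have "sqrt (2 * pi * \<tau>\<^sup>2) = sqrt D * sqrt (2 * pi * (\<tau> / sqrt D)\<^sup>2)"
      using D0 by (subst real_sqrt_mult[symmetric]) (simp add: power_divide)
    ultimately show ?thesis
      by (simp add: normal_density_def mult_exp_exp)
  qed
  have "(\<integral>\<^sup>+\<omega>. ennreal (exp (- s * (Y \<omega>)\<^sup>2)) \<partial>M)
    = (\<integral>\<^sup>+y. ennreal (normal_density m \<tau> y) * ennreal (exp (- s * y\<^sup>2)) \<partial>lborel)"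
    by (rule distributed_nn_integral[OF Y, symmetric]) measurable
  also have "\<dots> = (\<integral>\<^sup>+y. ennreal (exp (- s * m\<^sup>2 / D) / sqrt D) * ennreal (normal_density (m / D) (\<tau> / sqrt D) y) \<partial>lborel)"
    by (intro nn_integral_cong, subst (1 2) ennreal_mult[symmetric])
       (use eq D0 in \<open>auto simp: normal_density_nonneg\<close>)
  also have "\<dots> = ennreal (exp (- s * m\<^sup>2 / D) / sqrt D) * (\<integral>\<^sup>+y. ennreal (normal_density (m / D) (\<tau> / sqrt D) y) \<partial>lborel)"
    by (rule nn_integral_cmult) measurable
  also have "(\<integral>\<^sup>+y. ennreal (normal_density (m / D) (\<tau> / sqrt D) y) \<partial>lborel) = 1"
    using \<open>0 < \<tau>\<close> D0 by (subst nn_integral_eq_integral) (auto simp: normal_density_nonneg)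
  finally show ?thesis by (simp add: D_def)
qed

lemma (in prob_space) distributed_normal_linear_form:
  assumes "finite K" and ind: "indep_vars (\<lambda>_. borel) X K"
    and X: "\<And>i. i \<in> K \<Longrightarrow> distributed M lborel (X i) (normal_density (\<mu> i) \<sigma>)"
    and "0 < \<sigma>" "0 < \<tau>" and \<tau>: "(\<Sum>i\<in>K. (c i)\<^sup>2) = \<tau>\<^sup>2"
  shows "distributed M lborel (\<lambda>\<omega>. b + (\<Sum>i\<in>K. c i * X i \<omega>)) (normal_density (b + (\<Sum>i\<in>K. c i * \<mu> i)) (\<tau> * \<sigma>))"
proof -
  \<comment> \<open>Terms with zero coefficient are degenerate and are dropped, because the sum rule
    for independent normals asks for positive deviations. \<open>\<tau> > 0\<close> keeps the rest
    nonempty.\<close>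
  define K' where "K' = {i\<in>K. c i \<noteq> 0}"
  have K': "finite K'" "K' \<subseteq> K" using \<open>finite K\<close> by (auto simp: K'_def)
  have restr: "(\<Sum>i\<in>K. c i * f i) = (\<Sum>i\<in>K'. c i * f i)" for f :: "_ \<Rightarrow> real"
    using \<open>finite K\<close> by (intro sum.mono_neutral_right) (auto simp: K'_def)
  have sq: "(\<Sum>i\<in>K'. (\<bar>c i\<bar> * \<sigma>)\<^sup>2) = (\<tau> * \<sigma>)\<^sup>2"
  proof -
    have "(\<Sum>i\<in>K'. (c i)\<^sup>2) = \<tau>\<^sup>2"
      using restr[of c] \<tau> by (simp add: power2_eq_square)
    then show ?thesis
      by (simp add: power_mult_distrib sum_distrib_right[symmetric])
  qed
  have "K' \<noteq> {}"
    using sq \<open>0 < \<sigma>\<close> \<open>0 < \<tau>\<close> by auto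
  have "distributed M lborel (\<lambda>\<omega>. \<Sum>i\<in>K'. c i * X i \<omega>) (normal_density (\<Sum>i\<in>K'. c i * \<mu> i) (sqrt (\<Sum>i\<in>K'. (\<bar>c i\<bar> * \<sigma>)\<^sup>2)))"
  proof (rule sum_indep_normal[OF K'(1) \<open>K' \<noteq> {}\<close>])
    show "indep_vars (\<lambda>i. borel) (\<lambda>i \<omega>. c i * X i \<omega>) K'"
      by (rule indep_vars_compose2[OF indep_vars_subset[OF ind K'(2)], where Y = "\<lambda>i x. c i * x"]) simp
    show "0 < \<bar>c i\<bar> * \<sigma>" if "i \<in> K'" for i
      using that \<open>0 < \<sigma>\<close> by (simp add: K'_def)
    show "distributed M lborel (\<lambda>\<omega>. c i * X i \<omega>) (normal_density (c i * \<mu> i) (\<bar>c i\<bar> * \<sigma>))" if "i \<in> K'" for i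
      using normal_density_affine[OF X \<open>0 < \<sigma>\<close>, of i "c i" 0] that by (simp add: K'_def)
  qed
  then have "distributed M lborel (\<lambda>\<omega>. \<Sum>i\<in>K. c i * X i \<omega>) (normal_density (\<Sum>i\<in>K. c i * \<mu> i) (\<tau> * \<sigma>))"
    using \<open>0 < \<sigma>\<close> \<open>0 < \<tau>\<close> by (simp only: restr sq) simp
  from normal_density_affine[OF this, of 1 b] \<open>0 < \<sigma>\<close> \<open>0 < \<tau>\<close> show ?thesis
    by simp
qed

text \<open>Linear forms over disjoint index blocks are independent, so the Laplace transform
  factorizes; the common coefficient norm \<open>\<tau>\<close> merges the factors into one power.
  The design uses one block per time, the noise one block per output coordinate.\<close>

lemma (in prob_space) nn_integral_exp_sum_squares:
  assumes "finite J" and fin: "\<And>j. j \<in> J \<Longrightarrow> finite (K j)" and disj: "disjoint_family_on K J"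
    and ind: "indep_vars (\<lambda>_. borel) X I" and KI: "\<And>j. j \<in> J \<Longrightarrow> K j \<subseteq> I"
    and X: "\<And>j i. j \<in> J \<Longrightarrow> i \<in> K j \<Longrightarrow> distributed M lborel (X i) (normal_density (\<mu> i) \<sigma>)"
    and "0 < \<sigma>" "0 < \<tau>" and \<tau>: "\<And>j. j \<in> J \<Longrightarrow> (\<Sum>i\<in>K j. (c j i)\<^sup>2) = \<tau>\<^sup>2"
    and D: "0 < 1 + 2 * s * (\<tau> * \<sigma>)\<^sup>2"
  shows "(\<integral>\<^sup>+\<omega>. ennreal (exp (- s * (\<Sum>j\<in>J. (b j + (\<Sum>i\<in>K j. c j i * X i \<omega>))\<^sup>2))) \<partial>M)
    = ennreal (exp (- s * (\<Sum>j\<in>J. (b j + (\<Sum>i\<in>K j. c j i * \<mu> i))\<^sup>2) / (1 + 2 * s * (\<tau> * \<sigma>)\<^sup>2))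
        * (1 + 2 * s * (\<tau> * \<sigma>)\<^sup>2) powr (- (real (card J) / 2)))"
proof -
  define D where "D = 1 + 2 * s * (\<tau> * \<sigma>)\<^sup>2"
  have D0: "D > 0" using D by (simp add: D_def)
  define g where "g j f = ennreal (exp (- s * (b j + (\<Sum>i\<in>K j. c j i * f i))\<^sup>2))" for j and f :: "_ \<Rightarrow> real"
  have "indep_vars (\<lambda>_. borel) (\<lambda>j \<omega>. g j (restrict (\<lambda>i. X i \<omega>) (K j))) J"
  proof (rule indep_vars_compose2[OF indep_vars_restrict[OF ind KI disj]])
    show "g j \<in> PiM (K j) (\<lambda>_. borel) \<rightarrow>\<^sub>M borel" for j
      unfolding g_def by measurable
  qed
  then have ig: "indep_vars (\<lambda>_. borel) (\<lambda>j \<omega>. g j (\<lambda>i. X i \<omega>)) J"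
    by (simp add: g_def cong: sum.cong)
  have "(\<integral>\<^sup>+\<omega>. ennreal (exp (- s * (\<Sum>j\<in>J. (b j + (\<Sum>i\<in>K j. c j i * X i \<omega>))\<^sup>2))) \<partial>M)
    = (\<integral>\<^sup>+\<omega>. (\<Prod>j\<in>J. g j (\<lambda>i. X i \<omega>)) \<partial>M)"
    unfolding g_def by (simp only: prod_ennreal exp_ge_zero exp_sum[OF \<open>finite J\<close>] sum_distrib_left)
  also have "\<dots> = (\<Prod>j\<in>J. \<integral>\<^sup>+\<omega>. g j (\<lambda>i. X i \<omega>) \<partial>M)"
    by (rule indep_vars_nn_integral[OF \<open>finite J\<close> ig]) simp
  also have "\<dots> = (\<Prod>j\<in>J. ennreal (exp (- s * (b j + (\<Sum>i\<in>K j. c j i * \<mu> i))\<^sup>2 / D) * D powr (- (1 / 2))))"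
  proof (rule prod.cong[OF refl])
    fix j assume j: "j \<in> J"
    have "distributed M lborel (\<lambda>\<omega>. b j + (\<Sum>i\<in>K j. c j i * X i \<omega>)) (normal_density (b j + (\<Sum>i\<in>K j. c j i * \<mu> i)) (\<tau> * \<sigma>))"
      using j by (intro distributed_normal_linear_form fin indep_vars_subset[OF ind] KI X \<open>0 < \<sigma>\<close> \<open>0 < \<tau>\<close> \<tau>)
    then have "(\<integral>\<^sup>+\<omega>. g j (\<lambda>i. X i \<omega>) \<partial>M) = ennreal (exp (- s * (b j + (\<Sum>i\<in>K j. c j i * \<mu> i))\<^sup>2 / D) / sqrt D)"
      unfolding g_def D_def by (rule nn_integral_exp_square_normal) (use D \<open>0 < \<sigma>\<close> \<open>0 < \<tau>\<close> in auto)
    then show "(\<integral>\<^sup>+\<omega>. g j (\<lambda>i. X i \<omega>) \<partial>M) = ennreal (exp (- s * (b j + (\<Sum>i\<in>K j. c j i * \<mu> i))\<^sup>2 / D) * D powr (- (1 / 2)))"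
      using D0 by (simp only: powr_minus_divide powr_half_sqrt[OF less_imp_le] times_divide_eq_right mult_1_right)
  qed
  also have "\<dots> = ennreal (exp (- s * (\<Sum>j\<in>J. (b j + (\<Sum>i\<in>K j. c j i * \<mu> i))\<^sup>2) / D) * (D powr (- (1 / 2))) ^ card J)"
    unfolding sum_distrib_left sum_divide_distrib exp_sum[OF \<open>finite J\<close>]
    by (subst prod_ennreal) (simp_all add: prod.distrib)
  also have "(D powr (- (1 / 2))) ^ card J = D powr (- (real (card J) / 2))"
    using D0 by (simp add: powr_realpow[symmetric] powr_powr)
  finally show ?thesis by (simp add: D_def)
qed

subsection \<open>Matrices, the smallest eigenvalue and the pseudoinverse\<close>

lemma outer_mult_vec: "outer u v *v w = (v \<bullet> w) *\<^sub>R u"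
  by (simp add: vec_eq_iff outer_def matrix_vector_mult_def inner_vec_def sum_distrib_left mult_ac)

lemma sum_matrix_vec: "(\<Sum>j\<in>J. A j) *v w = (\<Sum>j\<in>J. A j *v w)" for A :: "'j \<Rightarrow> real^'n^'m"
  by (induction J rule: infinite_finite_induct) (auto simp: matrix_vector_mult_add_rdistrib)

lemma continuous_on_matrix_mult:
  fixes f :: "'a::topological_space \<Rightarrow> real^'n^'m" and g :: "'a \<Rightarrow> real^'k^'n"
  shows "continuous_on S f \<Longrightarrow> continuous_on S g \<Longrightarrow> continuous_on S (\<lambda>x. f x ** g x)"
  unfolding matrix_matrix_mult_def by (intro continuous_intros)

lemma continuous_on_transpose:
  fixes f :: "'a::topological_space \<Rightarrow> real^'n^'m"
  shows "continuous_on S f \<Longrightarrow> continuous_on S (\<lambda>x. transpose (f x))"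
  unfolding transpose_def by (intro continuous_intros)

lemma continuous_on_outer:
  fixes f :: "'a::topological_space \<Rightarrow> real^'n" and g :: "'a \<Rightarrow> real^'m"
  shows "continuous_on S f \<Longrightarrow> continuous_on S g \<Longrightarrow> continuous_on S (\<lambda>x. outer (f x) (g x))"
  unfolding outer_def by (intro continuous_intros)

text \<open>A minimizer \<open>v\<close> of the quadratic form on the sphere has value
  \<open>c\<close>, so \<open>h = A - c\<close> is positive semidefinite with
  \<open>v \<bullet> h v = 0\<close>. Perturbing \<open>v\<close> in the direction
  \<open>h v\<close> then forces \<open>h v = 0\<close>.\<close>

lemma symmetric_min_eigenvector:
  fixes A :: "real^'n^'n"
  assumes "transpose A = A"
  shows "\<exists>c v. norm v = 1 \<and> A *v v = c *\<^sub>R v \<and> (\<forall>u. c * (u \<bullet> u) \<le> u \<bullet> (A *v u))"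
proof -
  have "continuous_on (sphere 0 1) (\<lambda>u. u \<bullet> (A *v u))"
    unfolding matrix_vector_mult_def by (intro continuous_intros)
  moreover have "sphere (0::real^'n) 1 \<noteq> {}" by simp
  ultimately obtain v where v: "norm v = 1" and min: "\<And>u. norm u = 1 \<Longrightarrow> v \<bullet> (A *v v) \<le> u \<bullet> (A *v u)"
    using continuous_attains_inf[of "sphere (0::real^'n) 1" "\<lambda>u. u \<bullet> (A *v u)"] by (auto simp: dist_norm)
  define c where "c = v \<bullet> (A *v v)"
  define h where "h u = A *v u - c *\<^sub>R u" for u
  have sym: "x \<bullet> (A *v y) = (A *v x) \<bullet> y" for x y
    by (metis assms dot_lmul_matrix vector_transpose_matrix inner_commute)
  have low: "c * (u \<bullet> u) \<le> u \<bullet> (A *v u)" for u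
  proof (cases "u = 0")
    case False
    then have "c \<le> ((1 / norm u) *\<^sub>R u) \<bullet> (A *v ((1 / norm u) *\<^sub>R u))"
      unfolding c_def by (intro min) simp
    then have "c \<le> (u \<bullet> (A *v u)) / (norm u)\<^sup>2"
      by (simp add: matrix_vector_mult_scaleR power2_eq_square)
    then show ?thesis
      using False by (simp add: field_simps power2_norm_eq_inner)
  qed simp
  define b where "b = h v \<bullet> h v"
  define d where "d = h v \<bullet> h (h v)"
  have hlin: "h (x + s *\<^sub>R y) = h x + s *\<^sub>R h y" for x y s
    by (simp add: h_def matrix_vector_right_distrib matrix_vector_mult_scaleR algebra_simps)
  have hsym: "x \<bullet> h y = h x \<bullet> y" for x y
    by (simp add: h_def inner_diff_left inner_diff_right sym)
  have hpos: "0 \<le> x \<bullet> h x" for x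
    using low[of x] by (simp add: h_def inner_diff_right)
  have "v \<bullet> h v = 0"
    using v by (simp add: h_def inner_diff_right c_def dot_square_norm)
  then have quad: "0 \<le> s * (2 * b + s * d)" for s
    using hpos[of "v + s *\<^sub>R h v"] hsym[of v "h v"]
    by (simp add: hlin inner_add_left inner_add_right b_def d_def algebra_simps)
  have "b = 0"
  proof (rule ccontr)
    assume "b \<noteq> 0"
    then have b: "b > 0" by (simp add: b_def)
    have d: "d \<ge> 0" using hpos[of "h v"] by (simp add: d_def)
    \<comment> \<open>A negative step this small makes the quadratic negative; the denominator
      \<open>d + b\<close> instead of \<open>d\<close> also covers \<open>d = 0\<close>.\<close>
    have "0 \<le> (- (b / (d + b))) * (2 * b + (- (b / (d + b))) * d)" by (rule quad)
    also have "\<dots> = - (b\<^sup>2 * (d + 2 * b) / (d + b)\<^sup>2)"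
      using b d by (simp add: divide_simps) (simp add: algebra_simps power2_eq_square)
    also have "\<dots> < 0" using b d by simp
    finally show False by simp
  qed
  then have "A *v v = c *\<^sub>R v" by (simp add: b_def h_def)
  then show ?thesis using v low by blast
qed

text \<open>Every eigenvalue is positive here, so least in magnitude means least, and the choice
  made in \<open>lambda_min\<close> is pinned to the minimum of the Rayleigh quotient.\<close>

lemma lambda_min_positive_definite:
  fixes A :: "real^'n^'n"
  assumes "transpose A = A" and "k > 0" and k: "\<And>u. k * (u \<bullet> u) \<le> u \<bullet> (A *v u)"
  shows "k \<le> lambda_min A" and "lambda_min A * (u \<bullet> u) \<le> u \<bullet> (A *v u)"
proof -
  let ?P = "\<lambda>c. \<exists>v. v \<noteq> 0 \<and> A *v v = c *\<^sub>R v"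
  obtain c v where c: "norm v = 1" "A *v v = c *\<^sub>R v" and low: "\<And>u. c * (u \<bullet> u) \<le> u \<bullet> (A *v u)"
    using symmetric_min_eigenvector[OF assms(1)] by blast
  have "k \<le> c"
    using k[of v] c by (simp add: dot_square_norm)
  have ge: "c \<le> d" if "?P d" for d
  proof -
    obtain w where w: "w \<noteq> 0" "A *v w = d *\<^sub>R w" using \<open>?P d\<close> by blast
    have "c * (w \<bullet> w) \<le> d * (w \<bullet> w)" using low[of w] w(2) by simp
    then show ?thesis using w(1) by (simp add: mult_le_cancel_right)
  qed
  have Pc: "?P c" using c by (intro exI[of _ v]) auto
  have min: "\<not> \<bar>d\<bar> < \<bar>c\<bar>" if "?P d" for d
    using ge[OF that] \<open>k > 0\<close> \<open>k \<le> c\<close> by simp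
  have "?P (lambda_min A) \<and> (\<forall>d. ?P d \<longrightarrow> \<not> \<bar>d\<bar> < \<bar>lambda_min A\<bar>)"
    unfolding lambda_min_def by (rule arg_minI[of ?P c abs]) (use Pc min in blast)+
  then have "lambda_min A = c"
    using ge[of "lambda_min A"] Pc \<open>k > 0\<close> \<open>k \<le> c\<close> by force
  then show "k \<le> lambda_min A" "lambda_min A * (u \<bullet> u) \<le> u \<bullet> (A *v u)"
    using \<open>k \<le> c\<close> low by auto
qed

section \<open>Moore-Penrose inverse: uniqueness and measurability\<close>

definition penrose :: "real^'n^'m \<Rightarrow> real^'m^'n \<Rightarrow> bool" where
  "penrose A B \<longleftrightarrow> A ** B ** A = A \<and> B ** A ** B = B \<and>
    transpose (A ** B) = A ** B \<and> transpose (B ** A) = B ** A"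

text \<open>The symmetry equations let the projections be transposed past each other, giving
  \<open>A ** B = A ** C\<close> and \<open>B ** A = C ** A\<close>; then
  \<open>B = B ** A ** B\<close> turns into \<open>C ** A ** C = C\<close>.\<close>

lemma penrose_unique:
  assumes "penrose A B" "penrose A C"
  shows "B = C"
proof -
  have "A ** B = transpose (A ** C ** A ** B)"
    using assms by (simp add: penrose_def)
  also have "\<dots> = transpose ((A ** C) ** (A ** B))"
    by (simp add: matrix_mul_assoc)
  also have "\<dots> = A ** B ** (A ** C)"
    by (subst matrix_transpose_mul) (use assms in \<open>simp add: penrose_def\<close>)
  also have "\<dots> = A ** C"
    using assms by (simp add: penrose_def matrix_mul_assoc)
  finally have AB: "A ** B = A ** C" .
  have "B ** A = transpose (B ** (A ** C ** A))"
    using assms by (simp add: penrose_def)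
  also have "\<dots> = transpose ((B ** A) ** (C ** A))"
    by (simp add: matrix_mul_assoc)
  also have "\<dots> = C ** A ** (B ** A)"
    by (subst matrix_transpose_mul) (use assms in \<open>simp add: penrose_def\<close>)
  also have "\<dots> = C ** (A ** B ** A)"
    by (simp add: matrix_mul_assoc)
  also have "\<dots> = C ** A"
    using assms by (simp add: penrose_def)
  finally have BA: "B ** A = C ** A" .
  have "B = C ** A ** B"
    using assms BA by (simp add: penrose_def)
  also have "\<dots> = C ** A ** C"
    using AB by (metis matrix_mul_assoc)
  finally show ?thesis
    using assms by (simp add: penrose_def)
qed

lemma pinv_eqI: "penrose A B \<Longrightarrow> pinv A = B"
  unfolding pinv_def penrose_def[symmetric] by (blast intro: penrose_unique)

lemma pinv_right_inverse:
  fixes A :: "real^'n^'n"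
  assumes "invertible A"
  shows "A ** pinv A = mat 1"
proof -
  obtain B where B: "A ** B = mat 1" "B ** A = mat 1"
    using assms by (auto simp: invertible_def)
  then have "pinv A = B"
    by (intro pinv_eqI) (simp add: penrose_def transpose_mat)
  with B show ?thesis by simp
qed

text \<open>
  The graph of \<^const>\<open>pinv\<close> is closed where the Penrose equations are solvable, so preimages of
  closed sets are countable unions of projections along compact sets. Outside, \<^const>\<open>pinv\<close> is the
  constant junk value of \<^term>\<open>THE B. False\<close>; hence solvability need not be known.
\<close>
lemma borel_measurable_pinv: "(pinv :: real^'n^'m \<Rightarrow> real^'m^'n) \<in> borel_measurable borel"
proof (rule borel_measurableI)
  fix S :: "(real^'m^'n) set"
  assume "open S"
  define D where "D C = {A :: real^'n^'m. \<exists>B\<in>C. penrose A B}" for C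
  have "closed {z :: (real^'m^'n) \<times> (real^'n^'m). penrose (snd z) (fst z)}"
    unfolding penrose_def
    by (intro closed_Collect_conj closed_Collect_eq continuous_on_matrix_mult continuous_on_transpose continuous_intros)
  then have clos: "closed (D (C \<inter> cball 0 r))" if "closed C" for C r
    using closed_compact_projection[of "C \<inter> cball 0 r" "{z. penrose (snd z) (fst z)}"] that
    by (simp add: D_def closed_Int_compact Bex_def conj_assoc)
  have DM: "D C \<in> sets borel" if "closed C" for C
  proof -
    have "D C = (\<Union>n::nat. D (C \<inter> cball 0 (real n)))"
    proof (intro set_eqI iffI)
      fix A
      assume "A \<in> D C"
      then obtain B where "B \<in> C" "penrose A B" by (auto simp: D_def)
      moreover obtain n :: nat where "norm B \<le> real n" using real_arch_simple by blast
      ultimately show "A \<in> (\<Union>n::nat. D (C \<inter> cball 0 (real n)))"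
        by (auto simp: D_def intro!: exI[of _ n] bexI[of _ B])
    qed (auto simp: D_def)
    also have "\<dots> \<in> sets borel"
      using clos[OF that] by auto
    finally show ?thesis .
  qed
  define c where "c = (THE B :: real^'m^'n. False)"
  have out: "pinv A = c" if "A \<notin> D UNIV" for A :: "real^'n^'m"
    using that by (simp add: pinv_def penrose_def[symmetric] D_def c_def)
  \<comment> \<open>By uniqueness, a solvable \<open>A\<close> lies in \<open>D (- S)\<close>
    exactly when its pseudoinverse is outside \<open>S\<close>; openness of \<open>S\<close> makes
    \<open>- S\<close> closed, so that \<open>DM\<close> applies.\<close>
  have "A \<in> pinv -` S \<longleftrightarrow> A \<in> (D UNIV - D (- S)) \<union> (if c \<in> S then - D UNIV else {})" for A :: "real^'n^'m"
  proof (cases "A \<in> D UNIV")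
    case True
    then obtain B where B: "penrose A B" by (auto simp: D_def)
    then have "pinv A = B" by (rule pinv_eqI)
    moreover have "A \<in> D (- S) \<longleftrightarrow> B \<notin> S"
      using B penrose_unique unfolding D_def by blast
    ultimately show ?thesis using True by auto
  next
    case False
    then show ?thesis using out[OF False] by auto
  qed
  then have "pinv -` S = (D UNIV - D (- S)) \<union> (if c \<in> S then - D UNIV else {})"
    by blast
  then show "pinv -` S \<inter> space borel \<in> sets borel"
    using DM[of UNIV] DM[of "- S"] \<open>open S\<close> by (auto simp: closed_Compl)
qed

section \<open>Spectral norm and the deterministic least-squares error\<close>

lemma spec_norm_le:
  fixes A :: "real^'n^'m"
  assumes "\<And>u. norm (A *v u) \<le> c * norm u"
  shows "spec_norm A \<le> c"
  unfolding spec_norm_def by (rule onorm_le) (rule assms)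

lemma closed_spec_norm_le: "closed {A :: real^'n^'m. spec_norm A \<le> c}"
proof -
  have "spec_norm A \<le> c \<longleftrightarrow> (\<forall>u. norm (A *v u) \<le> c * norm u)" for A :: "real^'n^'m"
  proof
    assume c: "spec_norm A \<le> c"
    show "\<forall>u. norm (A *v u) \<le> c * norm u"
    proof
      fix u
      have "norm (A *v u) \<le> spec_norm A * norm u"
        unfolding spec_norm_def by (rule onorm[OF matrix_vector_mul_bounded_linear])
      also have "\<dots> \<le> c * norm u" using c by (intro mult_right_mono) auto
      finally show "norm (A *v u) \<le> c * norm u" .
    qed
  qed (simp add: spec_norm_le)
  moreover have "closed {A :: real^'n^'m. \<forall>u. norm (A *v u) \<le> c * norm u}"
    unfolding matrix_vector_mult_def
    by (intro closed_Collect_all closed_Collect_le continuous_intros)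
  ultimately show ?thesis by simp
qed

text \<open>With \<open>V *v z = u\<close>, the quadratic form \<open>q\<close> at \<open>z\<close>
  equals \<open>z \<bullet> u\<close>. Cauchy-Schwarz and
  \<open>\<Lambda> * (norm z)\<^sup>2 \<le> q\<close> give
  \<open>\<Lambda> * q \<le> (norm u)\<^sup>2\<close>, so a noise bound relative to
  \<open>sqrt q\<close> costs only a factor \<open>1 / sqrt \<Lambda>\<close>.\<close>

lemma least_squares_error:
  fixes X :: "nat \<Rightarrow> real^'n" and E :: "nat \<Rightarrow> real^'l" and Theta :: "real^'n^'l"
  assumes "\<Lambda> > 0" and low: "\<And>z. \<Lambda> * (norm z)\<^sup>2 \<le> (\<Sum>j\<in>J. (X j \<bullet> z)\<^sup>2)"
    and noise: "\<And>z. norm (\<Sum>j\<in>J. (X j \<bullet> z) *\<^sub>R E j) \<le> g * sqrt (\<Sum>j\<in>J. (X j \<bullet> z)\<^sup>2)"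
    and "g \<ge> 0"
  shows "spec_norm ((\<Sum>j\<in>J. outer (Theta *v X j + E j) (X j)) ** pinv (\<Sum>j\<in>J. outer (X j) (X j)) - Theta)
    \<le> g / sqrt \<Lambda>"
proof (rule spec_norm_le)
  fix u :: "real^'n"
  define V where "V = (\<Sum>j\<in>J. outer (X j) (X j))"
  have V: "V *v z = (\<Sum>j\<in>J. (X j \<bullet> z) *\<^sub>R X j)" for z
    by (simp add: V_def sum_matrix_vec outer_mult_vec)
  have zV: "z \<bullet> (V *v z) = (\<Sum>j\<in>J. (X j \<bullet> z)\<^sup>2)" for z
    by (simp add: V inner_sum_right power2_eq_square inner_commute)
  have "z = 0" if "V *v z = 0" for z
    using low[of z] zV[of z] that \<open>\<Lambda> > 0\<close> by (simp add: mult_le_0_iff)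
  then have "invertible V"
    using matrix_left_invertible_ker[of V] by (auto simp: invertible_left_inverse)
  define z where "z = pinv V *v u"
  have Vz: "V *v z = u"
    using pinv_right_inverse[OF \<open>invertible V\<close>] by (simp add: z_def matrix_vector_mul_assoc)
  define q where "q = (\<Sum>j\<in>J. (X j \<bullet> z)\<^sup>2)"
  have "q \<le> norm z * norm u"
    using norm_cauchy_schwarz[of z u] zV[of z] by (simp add: Vz q_def)
  then have "q\<^sup>2 \<le> (norm z)\<^sup>2 * (norm u)\<^sup>2"
    by (metis power_mono power_mult_distrib q_def sum_nonneg zero_le_power2)
  then have "\<Lambda> * q\<^sup>2 \<le> (\<Lambda> * (norm z)\<^sup>2) * (norm u)\<^sup>2"
    using \<open>\<Lambda> > 0\<close> by simp
  also have "\<dots> \<le> q * (norm u)\<^sup>2"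
    using low[of z] by (intro mult_right_mono) (auto simp: q_def)
  finally have "\<Lambda> * q * q \<le> (norm u)\<^sup>2 * q"
    by (simp add: power2_eq_square mult_ac)
  moreover have "0 \<le> q" by (auto simp: q_def intro: sum_nonneg)
  ultimately have "\<Lambda> * q \<le> (norm u)\<^sup>2"
    by (cases "q = 0") auto
  then have "sqrt (\<Lambda> * q) \<le> norm u"
    by (simp add: real_le_lsqrt)
  then have sq: "sqrt q \<le> norm u / sqrt \<Lambda>"
    using \<open>\<Lambda> > 0\<close> by (simp add: real_sqrt_mult field_simps)
  \<comment> \<open>The signal part of the first term is \<open>Theta *v (V *v z)\<close>, which
    cancels against \<open>Theta *v u\<close>; only noise remains.\<close>
  have "((\<Sum>j\<in>J. outer (Theta *v X j + E j) (X j)) ** pinv V - Theta) *v u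
    = (\<Sum>j\<in>J. outer (Theta *v X j + E j) (X j)) *v z - Theta *v (V *v z)"
    by (simp add: matrix_vector_mult_diff_rdistrib matrix_vector_mul_assoc[symmetric] z_def Vz[unfolded z_def])
  also have "\<dots> = (\<Sum>j\<in>J. (X j \<bullet> z) *\<^sub>R E j)"
    by (simp add: V sum_matrix_vec outer_mult_vec scaleR_add_right sum.distrib
        linear_sum[OF matrix_vector_mul_linear] matrix_vector_mult_scaleR)
  finally have "norm (((\<Sum>j\<in>J. outer (Theta *v X j + E j) (X j)) ** pinv V - Theta) *v u) \<le> g * sqrt q"
    using noise[of z] by (simp add: q_def)
  also have "\<dots> \<le> g * (norm u / sqrt \<Lambda>)"
    using sq \<open>g \<ge> 0\<close> by (rule mult_left_mono)
  finally show "norm (((\<Sum>j\<in>J. outer (Theta *v X j + E j) (X j)) ** pinv (\<Sum>j\<in>J. outer (X j) (X j)) - Theta) *v u) \<le> g / sqrt \<Lambda> * norm u"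
    by (simp add: V_def mult_ac)
qed

subsection \<open>Design seminorms\<close>

text \<open>The seminorm \<open>v \<mapsto> sqrt (v \<bullet> (V *v v))\<close> of the Gram matrix
  \<open>V\<close> of the rows \<open>X j\<close>, written through \<open>L2_set\<close> to inherit
  the triangle inequality.\<close>

definition design_norm :: "nat set \<Rightarrow> (nat \<Rightarrow> real^'n) \<Rightarrow> real^'n \<Rightarrow> real" where
  "design_norm J X v = L2_set (\<lambda>j. X j \<bullet> v) J"

lemma design_norm_scaleR: "design_norm J X (c *\<^sub>R v) = \<bar>c\<bar> * design_norm J X v"
  by (simp add: design_norm_def L2_set_def power_mult_distrib sum_distrib_left[symmetric] real_sqrt_mult)

lemma design_norm_triangle: "design_norm J X (u + v) \<le> design_norm J X u + design_norm J X v"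
  unfolding design_norm_def inner_add_right by (rule L2_set_triangle_ineq)

lemma continuous_on_design_norm: "continuous_on S (design_norm J X)"
  unfolding design_norm_def L2_set_def by (intro continuous_intros)

lemma design_norm_nonneg: "0 \<le> design_norm J X v"
  by (simp add: design_norm_def L2_set_nonneg)

lemma design_norm_square: "(design_norm J X v)\<^sup>2 = (\<Sum>j\<in>J. (X j \<bullet> v)\<^sup>2)"
  by (simp add: design_norm_def L2_set_def sum_nonneg)

text \<open>At a maximizer \<open>v0\<close> of \<open>q\<close> on the compact
  \<open>p\<close>-unit sphere, homogeneity gives \<open>q v \<le> q v0 * p v\<close> for all
  \<open>v\<close>. Moving by at most \<open>e\<close> thus loses at most the fraction
  \<open>e\<close> of \<open>q v0\<close>, which yields the whole ball of bad vectors for the volume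
  argument.\<close>

lemma seminorm_large_near_maximizer:
  fixes p q :: "'a::euclidean_space \<Rightarrow> real"
  assumes p: "\<And>c v. p (c *\<^sub>R v) = \<bar>c\<bar> * p v" "continuous_on UNIV p" "k > 0" "\<And>v. k * norm v \<le> p v"
    and q: "\<And>c v. q (c *\<^sub>R v) = \<bar>c\<bar> * q v" "\<And>u v. q (u + v) \<le> q u + q v" "continuous_on UNIV q"
    and z: "K * p z < q z" and "0 \<le> e" "e \<le> 1"
  obtains v0 where "p v0 = 1" "\<And>v. p (v - v0) \<le> e \<Longrightarrow> (1 - e) * K \<le> q v"
proof -
  have pz: "p v > 0" if "v \<noteq> 0" for v
    by (rule less_le_trans[OF _ p(4)[of v]]) (use that \<open>k > 0\<close> in simp)
  have p0: "p 0 = 0" and q0: "q 0 = 0"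
    using p(1)[of 0 0] q(1)[of 0 0] by auto
  have "z \<noteq> 0" using z p0 q0 by auto
  define S where "S = {v. p v = 1}"
  have "closed S"
    unfolding S_def by (intro closed_Collect_eq p continuous_on_const)
  moreover have "bounded S"
    unfolding bounded_iff
  proof (intro exI ballI)
    fix v assume "v \<in> S"
    then have "k * norm v \<le> 1" using p(4)[of v] by (simp add: S_def)
    then show "norm v \<le> 1 / k" using \<open>k > 0\<close> by (simp add: field_simps)
  qed
  ultimately have "compact S" by (simp add: compact_eq_bounded_closed)
  have unit: "(1 / p v) *\<^sub>R v \<in> S" if "v \<noteq> 0" for v
    using pz[OF that] by (simp add: S_def p(1))
  obtain v0 where v0: "v0 \<in> S" and max: "\<And>v. v \<in> S \<Longrightarrow> q v \<le> q v0"
    using continuous_attains_sup[OF \<open>compact S\<close> _ continuous_on_subset[OF q(3)]] unit[OF \<open>z \<noteq> 0\<close>] by blast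
  have bound: "q v \<le> q v0 * p v" for v
  proof (cases "v = 0")
    case False
    from max[OF unit[OF this]] pz[OF this] show ?thesis
      by (simp add: q(1) field_simps)
  qed (simp add: p0 q0)
  have "K * p z < q v0 * p z" using z bound[of z] by linarith
  then have K: "K < q v0" using pz[OF \<open>z \<noteq> 0\<close>] by simp
  have "0 \<le> q v0"
  proof -
    have "q (- v0) = q v0" using q(1)[of "-1" v0] by simp
    then show ?thesis using q(2)[of v0 "- v0"] q0 by simp
  qed
  show ?thesis
  proof
    show "p v0 = 1" using v0 by (simp add: S_def)
    fix v assume v: "p (v - v0) \<le> e"
    have "p (v0 - v) = p (v - v0)" using p(1)[of "-1" "v - v0"] by simp
    then have "q (v0 - v) \<le> q v0 * e"
      using order_trans[OF bound[of "v0 - v"] mult_left_mono[OF _ \<open>0 \<le> q v0\<close>]] v by simp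
    then have "(1 - e) * q v0 \<le> q v"
      using q(2)[of "v0 - v" v] by (simp add: algebra_simps)
    moreover have "(1 - e) * K \<le> (1 - e) * q v0"
      using K \<open>e \<le> 1\<close> by (intro mult_left_mono) auto
    ultimately show "(1 - e) * K \<le> q v" by linarith
  qed
qed

lemma sum_Times: "(\<Sum>i\<in>A \<times> B. h i) = (\<Sum>a\<in>A. \<Sum>b\<in>B. h (a, b))"
  by (simp add: sum.cartesian_product)

text \<open>The shift \<open>b\<close> allows two uses: \<open>b j = - (\<mu> j \<bullet> v)\<close>
  removes the means and gives a central law, while zero shift keeps them and gives a noncentral
  one.\<close>

lemma (in prob_space) nn_integral_exp_design:
  fixes x :: "nat \<Rightarrow> 'a \<Rightarrow> real^'n"
  assumes "finite J" and ind: "indep_vars (\<lambda>_. borel) (\<lambda>(j, k) \<omega>. x j \<omega> $ k) (J \<times> UNIV)"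
    and x: "\<And>j k. j \<in> J \<Longrightarrow> distributed M lborel (\<lambda>\<omega>. x j \<omega> $ k) (normal_density (\<mu> j $ k) \<sigma>)"
    and "0 < \<sigma>" "v \<noteq> 0" and D: "0 < 1 + 2 * s * (norm v * \<sigma>)\<^sup>2"
  shows "(\<integral>\<^sup>+\<omega>. ennreal (exp (- s * (\<Sum>j\<in>J. (b j + x j \<omega> \<bullet> v)\<^sup>2))) \<partial>M)
    = ennreal (exp (- s * (\<Sum>j\<in>J. (b j + \<mu> j \<bullet> v)\<^sup>2) / (1 + 2 * s * (norm v * \<sigma>)\<^sup>2))
        * (1 + 2 * s * (norm v * \<sigma>)\<^sup>2) powr (- (real (card J) / 2)))"
proof -
  have vv: "(\<Sum>i\<in>{j} \<times> UNIV. (v $ snd i)\<^sup>2) = (norm v)\<^sup>2" for j :: nat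
    unfolding power2_norm_eq_inner by (simp add: sum_Times inner_vec_def power2_eq_square)
  have "(\<integral>\<^sup>+\<omega>. ennreal (exp (- s * (\<Sum>j\<in>J. (b j + (\<Sum>i\<in>{j} \<times> UNIV. v $ snd i * (case i of (j, k) \<Rightarrow> \<lambda>\<omega>. x j \<omega> $ k) \<omega>))\<^sup>2))) \<partial>M)
    = ennreal (exp (- s * (\<Sum>j\<in>J. (b j + (\<Sum>i\<in>{j} \<times> UNIV. v $ snd i * (case i of (j, k) \<Rightarrow> \<mu> j $ k)))\<^sup>2) / (1 + 2 * s * (norm v * \<sigma>)\<^sup>2))
        * (1 + 2 * s * (norm v * \<sigma>)\<^sup>2) powr (- (real (card J) / 2)))"
    by (rule nn_integral_exp_sum_squares[where I = "J \<times> UNIV"])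
       (use assms vv in \<open>auto simp: disjoint_family_on_def\<close>)
  then show ?thesis
    by (simp add: sum_Times inner_vec_def mult.commute)
qed

text \<open>Each output coordinate of the weighted noise sum is centred normal with deviation
  \<open>\<tau> * \<sigma>\<close>, and distinct coordinates use disjoint variables, so the squared
  norm is a scaled chi-square with \<open>CARD('l)\<close> degrees of freedom.\<close>

lemma (in prob_space) nn_integral_exp_noise:
  fixes \<eta> :: "nat \<Rightarrow> 'a \<Rightarrow> real^'l"
  assumes "finite J" and ind: "indep_vars (\<lambda>_. borel) (\<lambda>(j, k) \<omega>. \<eta> j \<omega> $ k) (J \<times> UNIV)"
    and \<eta>: "\<And>j k. j \<in> J \<Longrightarrow> distributed M lborel (\<lambda>\<omega>. \<eta> j \<omega> $ k) (normal_density 0 \<sigma>)"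
    and "0 < \<sigma>" "0 < \<tau>" and \<tau>: "(\<Sum>j\<in>J. (c j)\<^sup>2) = \<tau>\<^sup>2"
    and D: "0 < 1 + 2 * s * (\<tau> * \<sigma>)\<^sup>2"
  shows "(\<integral>\<^sup>+\<omega>. ennreal (exp (- s * (norm (\<Sum>j\<in>J. c j *\<^sub>R \<eta> j \<omega>))\<^sup>2)) \<partial>M)
    = ennreal ((1 + 2 * s * (\<tau> * \<sigma>)\<^sup>2) powr (- (real CARD('l) / 2)))"
proof -
  have cc: "(\<Sum>i\<in>J \<times> {a}. (c (fst i))\<^sup>2) = \<tau>\<^sup>2" for a :: 'l
    using \<tau> by (simp add: sum_Times)
  have "(\<integral>\<^sup>+\<omega>. ennreal (exp (- s * (\<Sum>a\<in>UNIV. (0 + (\<Sum>i\<in>J \<times> {a}. c (fst i) * (case i of (j, k) \<Rightarrow> \<lambda>\<omega>. \<eta> j \<omega> $ k) \<omega>))\<^sup>2))) \<partial>M)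
    = ennreal (exp (- s * (\<Sum>a\<in>(UNIV::'l set). (0 + (\<Sum>i\<in>J \<times> {a}. c (fst i) * 0))\<^sup>2) / (1 + 2 * s * (\<tau> * \<sigma>)\<^sup>2))
        * (1 + 2 * s * (\<tau> * \<sigma>)\<^sup>2) powr (- (real (card (UNIV::'l set)) / 2)))"
    by (rule nn_integral_exp_sum_squares[where I = "J \<times> UNIV"])
       (use assms cc in \<open>auto simp: disjoint_family_on_def\<close>)
  moreover have "(norm (\<Sum>j\<in>J. c j *\<^sub>R \<eta> j \<omega>))\<^sup>2 = (\<Sum>a\<in>UNIV. (\<Sum>j\<in>J. c j * \<eta> j \<omega> $ a)\<^sup>2)" for \<omega>
    unfolding power2_norm_eq_inner by (simp add: inner_vec_def power2_eq_square)
  ultimately show ?thesis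
    by (simp add: sum_Times)
qed

subsection \<open>Tail bounds for the design and the noise\<close>

lemma borel_measurable_vecI:
  fixes f :: "'a \<Rightarrow> real^'n"
  assumes "\<And>k. (\<lambda>\<omega>. f \<omega> $ k) \<in> borel_measurable M"
  shows "f \<in> borel_measurable M"
  by (subst borel_measurable_euclidean_space) (auto simp: Basis_vec_def inner_axis assms)

lemma borel_measurable_design_norm[measurable]:
  assumes "\<And>j. j \<in> J \<Longrightarrow> X j \<in> borel_measurable M" and "f \<in> borel_measurable M"
  shows "(\<lambda>z. design_norm J (\<lambda>j. X j z) (f z)) \<in> borel_measurable M"
proof -
  have "(\<lambda>z. \<Sum>j\<in>J. (X j z \<bullet> f z)\<^sup>2) \<in> borel_measurable M"
    using assms by (intro borel_measurable_sum borel_measurable_power borel_measurable_inner)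
  then show ?thesis
    unfolding design_norm_def L2_set_def by measurable
qed

lemma pred_le_Pair:
  fixes g :: "'a \<Rightarrow> 'b::topological_space \<Rightarrow> real"
  assumes "(\<lambda>z. g (fst z) (snd z)) \<in> borel_measurable (M \<Otimes>\<^sub>M borel)"
  shows "Measurable.pred (M \<Otimes>\<^sub>M borel) (\<lambda>z. c \<le> g (fst z) (snd z))"
  using assms by measurable

text \<open>The exponent is written \<open>- (- s) * f \<omega>\<close> to match the Laplace
  transforms at the negative parameter \<open>- s\<close>.\<close>

lemma (in prob_space) Chernoff_upper:
  assumes "f \<in> borel_measurable M" and "s > 0" and "(\<integral>\<^sup>+\<omega>. ennreal (exp (- (- s) * f \<omega>)) \<partial>M) \<le> ennreal B" and "B \<ge> 0"
  shows "emeasure M {\<omega>\<in>space M. a \<le> f \<omega>} \<le> ennreal (exp (- s * a) * B)"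
proof -
  have "emeasure M {\<omega>\<in>space M. a \<le> f \<omega>} \<le> ennreal (exp (- s * a)) * (\<integral>\<^sup>+\<omega>. ennreal (exp (s * f \<omega>)) * indicator (space M) \<omega> \<partial>M)"
    using assms by (intro Chernoff_ineq_nn_integral_ge) auto
  also have "(\<integral>\<^sup>+\<omega>. ennreal (exp (s * f \<omega>)) * indicator (space M) \<omega> \<partial>M) = (\<integral>\<^sup>+\<omega>. ennreal (exp (- (- s) * f \<omega>)) \<partial>M)"
    by (intro nn_integral_cong) auto
  also have "ennreal (exp (- s * a)) * \<dots> \<le> ennreal (exp (- s * a)) * ennreal B"
    by (intro mult_left_mono assms) auto
  finally show ?thesis using assms by (simp add: ennreal_mult)
qed

lemma (in prob_space) Chernoff_lower:
  assumes "f \<in> borel_measurable M" and "s > 0" and "(\<integral>\<^sup>+\<omega>. ennreal (exp (- s * f \<omega>)) \<partial>M) \<le> ennreal B" and "B \<ge> 0"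
  shows "emeasure M {\<omega>\<in>space M. f \<omega> \<le> a} \<le> ennreal (exp (s * a) * B)"
  using Chernoff_upper[of "\<lambda>\<omega>. - f \<omega>" s B "- a"] assms by simp

lemma powr_half_bound:
  assumes "1 / 2 \<le> y"
  shows "y powr (- (real n / 2)) \<le> 2 powr (real n / 2)"
proof -
  have "y powr (- (real n / 2)) \<le> (1 / 2) powr (- (real n / 2))"
    using assms by (intro powr_mono2') auto
  then show ?thesis by (simp add: powr_minus_divide powr_divide)
qed

context prob_space
begin

context
  fixes x :: "nat \<Rightarrow> 'a \<Rightarrow> real^'n" and \<mu> J \<sigma>
  assumes J: "finite J"
    and ind: "indep_vars (\<lambda>_. borel) (\<lambda>(j, k) \<omega>. x j \<omega> $ k) (J \<times> UNIV)"
    and x: "\<And>j k. j \<in> J \<Longrightarrow> distributed M lborel (\<lambda>\<omega>. x j \<omega> $ k) (normal_density (\<mu> j $ k) \<sigma>)"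
    and \<sigma>: "0 < \<sigma>"
begin

lemma design_measurable: "j \<in> J \<Longrightarrow> x j \<in> borel_measurable M"
  using distributed_measurable[OF x] by (intro borel_measurable_vecI) simp

text \<open>If the bound fails, a maximizer spoils a ball of radius \<open>1/4\<close> at level
  \<open>(3/4) * K\<close>; the ratio of volumes is \<open>5\<close> per dimension. The constant
  \<open>3\<close> leaves a gain of \<open>81/100\<close> per observation, more than the Laplace
  cost \<open>ln 2 / 2\<close>.\<close>

lemma design_deviation_bound:
  "\<exists>A\<in>sets M. emeasure M A \<le> ennreal (5 ^ CARD('n) * (exp (- (81/100) * card J) * 2 powr (card J / 2))) \<and>
    (\<forall>\<omega>\<in>space M - A. \<forall>v. design_norm J (\<lambda>j. x j \<omega> - \<mu> j) v \<le> 3 * sqrt (card J) * \<sigma> * norm v)"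
proof -
  define K where "K = 3 * sqrt (card J) * \<sigma>"
  define dn where "dn \<omega> v = design_norm J (\<lambda>j. x j \<omega> - \<mu> j) v" for \<omega> v
  have "\<exists>A\<in>sets M. emeasure M A \<le> ennreal (((1 + 1/4) / (1/4)) ^ DIM(real^'n) * (exp (- (81/100) * card J) * 2 powr (card J / 2))) \<and>
    (\<forall>\<omega>\<in>space M. \<forall>v0. norm v0 = 1 \<longrightarrow> (\<forall>v. norm (v - v0) \<le> 1/4 \<longrightarrow> (1 - 1/4) * K \<le> dn \<omega> v) \<longrightarrow> \<omega> \<in> A)"
  proof (rule volume_union_bound[where p = norm and e = "1/4" and Q = "\<lambda>\<omega> v. (1 - 1/4) * K \<le> dn \<omega> v" and k = 1])
    show "Measurable.pred (M \<Otimes>\<^sub>M borel) (\<lambda>z. (1 - 1/4) * K \<le> dn (fst z) (snd z))"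
      unfolding dn_def
      by (intro pred_le_Pair borel_measurable_design_norm measurable_snd borel_measurable_diff
          measurable_compose[OF measurable_fst] design_measurable) auto
    fix v :: "real^'n"
    assume v: "1 - 1/4 \<le> norm v" "norm v \<le> 1 + 1/4"
    define f where "f \<omega> = (\<Sum>j\<in>J. (- (\<mu> j \<bullet> v) + x j \<omega> \<bullet> v)\<^sup>2)" for \<omega>
    have dn_f: "(dn \<omega> v)\<^sup>2 = f \<omega>" for \<omega>
      by (simp add: dn_def f_def design_norm_square inner_diff_left)
    \<comment> \<open>Chosen so that \<open>2 * s * (5/4 * \<sigma>)\<^sup>2 = 1/2\<close>: on the
      shell, where \<open>norm v \<le> 5/4\<close>, the base of the Laplace transform stays at least
      \<open>1/2\<close>.\<close>
    define s where "s = 16 / (100 * \<sigma>\<^sup>2)"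
    have s: "s > 0" using \<sigma> by (simp add: s_def)
    have vv: "(norm v)\<^sup>2 \<le> (5/4)\<^sup>2" using v by (intro power_mono) auto
    have D: "1 / 2 \<le> 1 + 2 * (- s) * (norm v * \<sigma>)\<^sup>2"
      using vv \<sigma> by (simp add: s_def power_mult_distrib power2_eq_square)
    have "(\<integral>\<^sup>+\<omega>. ennreal (exp (- (- s) * f \<omega>)) \<partial>M) = ennreal (1 * (1 + 2 * (- s) * (norm v * \<sigma>)\<^sup>2) powr (- (real (card J) / 2)))"
      unfolding f_def
      by (subst nn_integral_exp_design[OF J ind x \<sigma>]) (use v D in auto)
    also have "\<dots> \<le> ennreal (2 powr (card J / 2))"
      unfolding mult_1_left by (intro ennreal_leI powr_half_bound[OF D])
    finally have L: "(\<integral>\<^sup>+\<omega>. ennreal (exp (- (- s) * f \<omega>)) \<partial>M) \<le> ennreal (2 powr (card J / 2))" .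
    have "{\<omega>\<in>space M. (1 - 1/4) * K \<le> dn \<omega> v} = {\<omega>\<in>space M. ((1 - 1/4) * K)\<^sup>2 \<le> f \<omega>}"
    proof -
      have "0 \<le> (1 - 1/4) * K" "0 \<le> dn \<omega> v" for \<omega>
        using \<sigma> by (auto simp: K_def dn_def design_norm_nonneg)
      then show ?thesis by (simp add: dn_f[symmetric] abs_le_square_iff[symmetric])
    qed
    also have "emeasure M \<dots> \<le> ennreal (exp (- s * ((1 - 1/4) * K)\<^sup>2) * 2 powr (card J / 2))"
    proof (rule Chernoff_upper[OF _ s L])
      show "f \<in> borel_measurable M"
        unfolding f_def[abs_def] using design_measurable by (intro borel_measurable_sum) auto
    qed simp
    also have "- s * ((1 - 1/4) * K)\<^sup>2 = - (81/100) * card J"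
      using \<sigma> by (simp add: s_def K_def power_mult_distrib) (simp add: power2_eq_square)
    finally show "emeasure M {\<omega>\<in>space M. (1 - 1/4) * K \<le> dn \<omega> v} \<le> ennreal (exp (- (81/100) * card J) * 2 powr (card J / 2))" .
  qed (auto intro: norm_triangle_ineq continuous_intros)
  then obtain A where A: "A \<in> sets M" "emeasure M A \<le> ennreal (5 ^ CARD('n) * (exp (- (81/100) * card J) * 2 powr (card J / 2)))"
    and mem: "\<And>\<omega> v0. \<omega> \<in> space M \<Longrightarrow> norm v0 = 1 \<Longrightarrow> (\<forall>v. norm (v - v0) \<le> 1/4 \<longrightarrow> (1 - 1/4) * K \<le> dn \<omega> v) \<Longrightarrow> \<omega> \<in> A"
    by auto
  have "dn \<omega> z \<le> K * norm z" if w: "\<omega> \<in> space M - A" for \<omega> z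
  proof (rule ccontr)
    assume "\<not> dn \<omega> z \<le> K * norm z"
    then have "K * norm z < dn \<omega> z" by simp
    then obtain v0 where "norm v0 = 1" "\<And>v. norm (v - v0) \<le> 1/4 \<Longrightarrow> (1 - 1/4) * K \<le> dn \<omega> v"
      unfolding dn_def
      by (rule seminorm_large_near_maximizer[where p = norm and k = 1 and e = "1/4", rotated 7])
         (auto simp: design_norm_scaleR intro: design_norm_triangle continuous_on_design_norm continuous_intros)
    then show False using mem[of \<omega> v0] w by blast
  qed
  then show ?thesis
    using A unfolding dn_def K_def by blast
qed

text \<open>A ball consisting of bad vectors only is improbable, so outside \<open>A\<close> each
  unit vector has a good vector nearby; a separate upper bound must carry the estimate over to the
  unit vector itself. The condition \<open>\<theta> * (1 + 2 * s) \<le> 1\<close> lets the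
  exponential gain from the means pay for the factor \<open>1 + m\<close>, so the failure
  probability is free of \<open>m\<close>.\<close>

lemma design_lower_tail:
  fixes m s \<theta> e \<delta> :: real
  assumes m: "0 \<le> m" "\<And>v. card J * \<sigma>\<^sup>2 * m * (norm v)\<^sup>2 \<le> (\<Sum>j\<in>J. (\<mu> j \<bullet> v)\<^sup>2)"
    and s: "0 < s" and \<theta>: "0 \<le> \<theta>" "\<theta> * (1 + 2 * s) \<le> 1" and e: "0 < e" "e < 1"
    and p: "((1 + e) / e) ^ CARD('n) * (exp (s * \<theta> * card J) * (1 + 2 * s) powr (- (card J / 2))) \<le> \<delta>"
  shows "\<exists>A\<in>sets M. emeasure M A \<le> ennreal \<delta> \<and>
    (\<forall>\<omega>\<in>space M - A. \<forall>v0. norm v0 = 1 \<longrightarrow>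
      (\<exists>v. norm (v - v0) \<le> e \<and> sqrt (\<theta> * card J * (1 + m)) * \<sigma> * norm v < design_norm J (\<lambda>j. x j \<omega>) v))"
proof -
  define K where "K = sqrt (\<theta> * card J * (1 + m)) * \<sigma>"
  define dn where "dn \<omega> v = design_norm J (\<lambda>j. x j \<omega>) v" for \<omega> v
  have "\<exists>A\<in>sets M. emeasure M A \<le> ennreal (((1 + e) / e) ^ DIM(real^'n) * (exp (s * \<theta> * card J) * (1 + 2 * s) powr (- (card J / 2)))) \<and>
    (\<forall>\<omega>\<in>space M. \<forall>v0. norm v0 = 1 \<longrightarrow> (\<forall>v. norm (v - v0) \<le> e \<longrightarrow> 0 \<le> K * norm v - dn \<omega> v) \<longrightarrow> \<omega> \<in> A)"
  proof (rule volume_union_bound[where p = norm and Q = "\<lambda>\<omega> v. 0 \<le> K * norm v - dn \<omega> v" and k = 1])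
    show "Measurable.pred (M \<Otimes>\<^sub>M borel) (\<lambda>z. 0 \<le> K * norm (snd z) - dn (fst z) (snd z))"
      unfolding dn_def
      by (intro pred_le_Pair borel_measurable_diff borel_measurable_times borel_measurable_norm
          borel_measurable_design_norm measurable_snd measurable_compose[OF measurable_fst] design_measurable) auto
    fix v :: "real^'n"
    assume v: "1 - e \<le> norm v" "norm v \<le> 1 + e"
    then have v0: "norm v > 0" "v \<noteq> 0" using e by auto
    define f where "f \<omega> = (\<Sum>j\<in>J. (0 + x j \<omega> \<bullet> v)\<^sup>2)" for \<omega>
    have dn_f: "(dn \<omega> v)\<^sup>2 = f \<omega>" for \<omega>
      by (simp add: dn_def f_def design_norm_square)
    \<comment> \<open>The tilt is rescaled by the variance of
      \<open>x j \<omega> \<bullet> v\<close>, so that the base is \<open>1 + 2 * s\<close> for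
      every \<open>v\<close>.\<close>
    define s' where "s' = s / (norm v * \<sigma>)\<^sup>2"
    have s': "s' > 0" "s' * (norm v * \<sigma>)\<^sup>2 = s" using \<sigma> s v0 by (auto simp: s'_def)
    have D: "1 + 2 * s' * (norm v * \<sigma>)\<^sup>2 = 1 + 2 * s"
      using s' by (simp add: mult.assoc)
    have "s * (card J * m) = s' * (card J * \<sigma>\<^sup>2 * m * (norm v)\<^sup>2)"
      unfolding s'(2)[symmetric] by (simp add: power_mult_distrib mult_ac)
    also have "\<dots> \<le> s' * (\<Sum>j\<in>J. (\<mu> j \<bullet> v)\<^sup>2)"
      using m(2)[of v] s' by (intro mult_left_mono) auto
    finally have sm: "s * (card J * m) \<le> s' * (\<Sum>j\<in>J. (0 + \<mu> j \<bullet> v)\<^sup>2)" by simp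
    define B where "B = exp (- (s * (card J * m) / (1 + 2 * s))) * (1 + 2 * s) powr (- (card J / 2))"
    have "(\<integral>\<^sup>+\<omega>. ennreal (exp (- s' * f \<omega>)) \<partial>M) = ennreal (exp (- s' * (\<Sum>j\<in>J. (0 + \<mu> j \<bullet> v)\<^sup>2) / (1 + 2 * s)) * (1 + 2 * s) powr (- (real (card J) / 2)))"
      unfolding f_def
      by (rule nn_integral_exp_design[OF J ind x \<sigma> v0(2), where s = s' and b = "\<lambda>_. 0", unfolded D])
         (use s in auto)
    also have "\<dots> \<le> ennreal B"
      unfolding B_def using sm s by (intro ennreal_leI mult_right_mono) (auto intro: divide_right_mono)
    finally have L: "(\<integral>\<^sup>+\<omega>. ennreal (exp (- s' * f \<omega>)) \<partial>M) \<le> ennreal B" .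
    have "{\<omega>\<in>space M. 0 \<le> K * norm v - dn \<omega> v} = {\<omega>\<in>space M. f \<omega> \<le> (K * norm v)\<^sup>2}"
    proof -
      have "0 \<le> K * norm v" "0 \<le> dn \<omega> v" for \<omega>
        using \<sigma> m \<theta> by (auto simp: K_def dn_def design_norm_nonneg)
      then show ?thesis by (simp add: dn_f[symmetric] abs_le_square_iff[symmetric])
    qed
    also have "emeasure M \<dots> \<le> ennreal (exp (s' * (K * norm v)\<^sup>2) * B)"
    proof (rule Chernoff_lower[OF _ s'(1) L])
      show "f \<in> borel_measurable M"
        unfolding f_def[abs_def] using design_measurable by (intro borel_measurable_sum) auto
    qed (simp add: B_def)
    also have "\<dots> \<le> ennreal (exp (s * \<theta> * card J) * (1 + 2 * s) powr (- (card J / 2)))"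
    proof -
      have "s' * (K * norm v)\<^sup>2 = s * \<theta> * card J * (1 + m)"
        unfolding s'(2)[symmetric] using m \<theta> by (simp add: K_def power_mult_distrib mult_ac)
      moreover have "\<theta> \<le> 1 / (1 + 2 * s)"
        using \<theta> s by (simp add: field_simps)
      then have "s * (card J * m) * \<theta> \<le> s * (card J * m) * (1 / (1 + 2 * s))"
        using s m by (intro mult_left_mono) auto
      ultimately have "s' * (K * norm v)\<^sup>2 + - (s * (card J * m) / (1 + 2 * s)) \<le> s * \<theta> * card J"
        by (simp add: algebra_simps)
      then have "exp (s' * (K * norm v)\<^sup>2) * exp (- (s * (card J * m) / (1 + 2 * s))) \<le> exp (s * \<theta> * card J)"
        unfolding mult_exp_exp by simp
      then show ?thesis
        unfolding B_def mult.assoc[symmetric] by (intro ennreal_leI mult_right_mono) auto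
    qed
    finally show "emeasure M {\<omega>\<in>space M. 0 \<le> K * norm v - dn \<omega> v} \<le> ennreal (exp (s * \<theta> * card J) * (1 + 2 * s) powr (- (card J / 2)))" .
  qed (use e in \<open>auto intro: norm_triangle_ineq continuous_intros\<close>)
  then obtain A where A: "A \<in> sets M" "emeasure M A \<le> ennreal (((1 + e) / e) ^ CARD('n) * (exp (s * \<theta> * card J) * (1 + 2 * s) powr (- (card J / 2))))"
    and mem: "\<And>\<omega> v0. \<omega> \<in> space M \<Longrightarrow> norm v0 = 1 \<Longrightarrow> (\<forall>v. norm (v - v0) \<le> e \<longrightarrow> 0 \<le> K * norm v - dn \<omega> v) \<Longrightarrow> \<omega> \<in> A"
    by auto
  show ?thesis
  proof (intro bexI[OF _ A(1)] conjI ballI allI impI)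
    show "emeasure M A \<le> ennreal \<delta>"
      using A(2) ennreal_leI[OF p] by (rule order_trans)
  next
    fix \<omega> and v0 :: "real^'n" assume "\<omega> \<in> space M - A" "norm v0 = 1"
    then have "\<not> (\<forall>v. norm (v - v0) \<le> e \<longrightarrow> 0 \<le> K * norm v - dn \<omega> v)"
      using mem[of \<omega> v0] by blast
    then show "\<exists>v. norm (v - v0) \<le> e \<and> sqrt (\<theta> * card J * (1 + m)) * \<sigma> * norm v < design_norm J (\<lambda>j. x j \<omega>) v"
      unfolding K_def[symmetric] dn_def by force
  qed
qed

end

text \<open>Balls are taken in the seminorm of the fixed design, relative to which the noise has the
  same variance in all directions; \<open>k\<close> makes it a norm. The resulting bound does not
  depend on how well conditioned the design is.\<close>

lemma noise_bound:
  fixes \<eta> :: "nat \<Rightarrow> 'a \<Rightarrow> real^'l" and X :: "nat \<Rightarrow> real^'n"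
  assumes J: "finite J"
    and ind: "indep_vars (\<lambda>_. borel) (\<lambda>(j, k) \<omega>. \<eta> j \<omega> $ k) (J \<times> UNIV)"
    and \<eta>: "\<And>j k. j \<in> J \<Longrightarrow> distributed M lborel (\<lambda>\<omega>. \<eta> j \<omega> $ k) (normal_density 0 \<sigma>)"
    and \<sigma>: "0 < \<sigma>" and k: "k > 0" "\<And>v. k * norm v \<le> design_norm J X v" and g: "g \<ge> 0"
  shows "\<exists>A\<in>sets M. emeasure M A \<le> ennreal (8 ^ CARD('n) * (exp (- (9/64) * g\<^sup>2) * 2 powr (CARD('l) / 2))) \<and>
    (\<forall>\<omega>\<in>space M - A. \<forall>v. norm (\<Sum>j\<in>J. (X j \<bullet> v) *\<^sub>R \<eta> j \<omega>) \<le> g * \<sigma> * design_norm J X v)"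
proof -
  define K where "K = g * \<sigma>"
  define p where "p = design_norm J X"
  define q where "q \<omega> v = norm (\<Sum>j\<in>J. (X j \<bullet> v) *\<^sub>R \<eta> j \<omega>)" for \<omega> v
  have p: "p (c *\<^sub>R v) = \<bar>c\<bar> * p v" "p (u + v) \<le> p u + p v" "continuous_on UNIV p" "k * norm v \<le> p v" for c u v
    using k by (auto simp: p_def design_norm_scaleR design_norm_triangle continuous_on_design_norm)
  have meas: "\<eta> j \<in> borel_measurable M" if "j \<in> J" for j
    using distributed_measurable[OF \<eta>[OF that]] by (intro borel_measurable_vecI) simp
  have "\<exists>A\<in>sets M. emeasure M A \<le> ennreal (((1 + 1/7) / (1/7)) ^ DIM(real^'n) * (exp (- (9/64) * g\<^sup>2) * 2 powr (CARD('l) / 2))) \<and>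
    (\<forall>\<omega>\<in>space M. \<forall>v0. p v0 = 1 \<longrightarrow> (\<forall>v. p (v - v0) \<le> 1/7 \<longrightarrow> (1 - 1/7) * K \<le> q \<omega> v) \<longrightarrow> \<omega> \<in> A)"
  proof (rule volume_union_bound[where p = p and e = "1/7" and Q = "\<lambda>\<omega> v. (1 - 1/7) * K \<le> q \<omega> v" and k = k])
    show "Measurable.pred (M \<Otimes>\<^sub>M borel) (\<lambda>z. (1 - 1/7) * K \<le> q (fst z) (snd z))"
    proof (rule pred_le_Pair)
      have "(\<lambda>z. \<Sum>j\<in>J. (X j \<bullet> snd z) *\<^sub>R \<eta> j (fst z)) \<in> borel_measurable (M \<Otimes>\<^sub>M borel)"
        by (intro borel_measurable_sum borel_measurable_scaleR borel_measurable_inner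
          measurable_snd measurable_compose[OF measurable_fst] meas) auto
      then show "(\<lambda>z. q (fst z) (snd z)) \<in> borel_measurable (M \<Otimes>\<^sub>M borel)"
        unfolding q_def by measurable
    qed
    fix v :: "real^'n"
    assume v: "1 - 1/7 \<le> p v" "p v \<le> 1 + 1/7"
    have vv: "(p v)\<^sup>2 \<le> (8/7)\<^sup>2" using v by (intro power_mono) auto
    \<comment> \<open>Here \<open>2 * s * (8/7 * \<sigma>)\<^sup>2 = 1/2\<close>, and the squared
      threshold factor \<open>(6/7)\<^sup>2\<close> turns the exponent into
      \<open>9/64\<close>.\<close>
    define s where "s = 49 / (256 * \<sigma>\<^sup>2)"
    have s: "s > 0" using \<sigma> by (simp add: s_def)
    have D: "1 / 2 \<le> 1 + 2 * (- s) * (p v * \<sigma>)\<^sup>2"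
      using vv \<sigma> by (simp add: s_def power_mult_distrib power2_eq_square)
    have "(\<integral>\<^sup>+\<omega>. ennreal (exp (- (- s) * (q \<omega> v)\<^sup>2)) \<partial>M) = ennreal ((1 + 2 * (- s) * (p v * \<sigma>)\<^sup>2) powr (- (real CARD('l) / 2)))"
      unfolding q_def
      by (rule nn_integral_exp_noise[OF J ind \<eta> \<sigma>]) (use v D in \<open>auto simp: p_def design_norm_square\<close>)
    also have "\<dots> \<le> ennreal (2 powr (CARD('l) / 2))"
      by (intro ennreal_leI powr_half_bound[OF D])
    finally have L: "(\<integral>\<^sup>+\<omega>. ennreal (exp (- (- s) * (q \<omega> v)\<^sup>2)) \<partial>M) \<le> ennreal (2 powr (CARD('l) / 2))" .
    have "{\<omega>\<in>space M. (1 - 1/7) * K \<le> q \<omega> v} = {\<omega>\<in>space M. ((1 - 1/7) * K)\<^sup>2 \<le> (q \<omega> v)\<^sup>2}"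
    proof -
      have "0 \<le> (1 - 1/7) * K" "0 \<le> q \<omega> v" for \<omega>
        using \<sigma> g by (auto simp: K_def q_def)
      then show ?thesis by (simp add: abs_le_square_iff[symmetric])
    qed
    also have "emeasure M \<dots> \<le> ennreal (exp (- s * ((1 - 1/7) * K)\<^sup>2) * 2 powr (CARD('l) / 2))"
    proof (rule Chernoff_upper[OF _ s L])
      show "(\<lambda>\<omega>. (q \<omega> v)\<^sup>2) \<in> borel_measurable M"
        unfolding q_def using meas by (intro borel_measurable_power borel_measurable_norm borel_measurable_sum) auto
    qed simp
    also have "- s * ((1 - 1/7) * K)\<^sup>2 = - (9/64) * g\<^sup>2"
      using \<sigma> by (simp add: s_def K_def power_mult_distrib) (simp add: power2_eq_square)
    finally show "emeasure M {\<omega>\<in>space M. (1 - 1/7) * K \<le> q \<omega> v} \<le> ennreal (exp (- (9/64) * g\<^sup>2) * 2 powr (CARD('l) / 2))" .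
  qed (use p k in auto)
  then obtain A where A: "A \<in> sets M" "emeasure M A \<le> ennreal (8 ^ CARD('n) * (exp (- (9/64) * g\<^sup>2) * 2 powr (CARD('l) / 2)))"
    and mem: "\<And>\<omega> v0. \<omega> \<in> space M \<Longrightarrow> p v0 = 1 \<Longrightarrow> (\<forall>v. p (v - v0) \<le> 1/7 \<longrightarrow> (1 - 1/7) * K \<le> q \<omega> v) \<Longrightarrow> \<omega> \<in> A"
    by auto
  have "q \<omega> z \<le> K * p z" if w: "\<omega> \<in> space M - A" for \<omega> z
  proof (rule ccontr)
    assume "\<not> q \<omega> z \<le> K * p z"
    then have z: "K * p z < q \<omega> z" by simp
    have q: "q \<omega> (c *\<^sub>R v) = \<bar>c\<bar> * q \<omega> v" "q \<omega> (u + v) \<le> q \<omega> u + q \<omega> v" "continuous_on UNIV (q \<omega>)" for c u v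
    proof -
      have "(\<Sum>j\<in>J. (X j \<bullet> (c *\<^sub>R v)) *\<^sub>R \<eta> j \<omega>) = c *\<^sub>R (\<Sum>j\<in>J. (X j \<bullet> v) *\<^sub>R \<eta> j \<omega>)"
        by (simp add: scaleR_sum_right)
      then show "q \<omega> (c *\<^sub>R v) = \<bar>c\<bar> * q \<omega> v" by (simp add: q_def)
      have "(\<Sum>j\<in>J. (X j \<bullet> (u + v)) *\<^sub>R \<eta> j \<omega>) = (\<Sum>j\<in>J. (X j \<bullet> u) *\<^sub>R \<eta> j \<omega>) + (\<Sum>j\<in>J. (X j \<bullet> v) *\<^sub>R \<eta> j \<omega>)"
        by (simp add: inner_add_right scaleR_add_left sum.distrib)
      then show "q \<omega> (u + v) \<le> q \<omega> u + q \<omega> v" by (simp add: q_def norm_triangle_ineq)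
      show "continuous_on UNIV (q \<omega>)" unfolding q_def by (intro continuous_intros)
    qed
    obtain v0 where "p v0 = 1" "\<And>v. p (v - v0) \<le> 1/7 \<Longrightarrow> (1 - 1/7) * K \<le> q \<omega> v"
      by (rule seminorm_large_near_maximizer[where p = p and q = "q \<omega>" and k = k and e = "1/7" and K = K and z = z])
         (use p q k z in auto)
    then show False using mem[of \<omega> v0] w by blast
  qed
  then show ?thesis
    using A unfolding q_def K_def p_def by blast
qed

end

subsection \<open>Numerical estimates\<close>

lemma exp_half_le: "exp (1/2 :: real) \<le> 5 / 3"
proof -
  have "(exp (1/2 :: real))\<^sup>2 = exp 1"
    by (simp add: exp_double[symmetric])
  also have "\<dots> \<le> (5/3)\<^sup>2"
    using e_less_272 by (simp add: power2_eq_square)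
  finally show ?thesis by (rule power2_le_imp_le) simp
qed

lemma deviation_failure_probability:
  fixes \<delta> :: real and n t :: nat
  assumes \<delta>: "0 < \<delta>" "\<delta> < 1/4" and t: "8 * real n + 16 * ln (2 / \<delta>) \<le> real t"
  shows "5 ^ n * (exp (- (81/100) * t) * 2 powr (t / 2)) \<le> \<delta>"
proof -
  have L: "ln (2 / \<delta>) = ln 2 - ln \<delta>" "ln \<delta> \<le> 0"
    using \<delta> by (auto simp: ln_div)
  \<comment> \<open>Replacing \<open>5\<close> by \<open>8 = 2 ^ 3\<close> expresses the costs
    through \<open>ln 2\<close>, for which the rational bounds \<open>2/3\<close> and
    \<open>25/36\<close> suffice.\<close>
  have "(5::real) ^ n \<le> 8 ^ n" by (rule power_mono) auto
  also have "(8::real) ^ n = exp (real n * (3 * ln 2))"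
    by (simp add: exp_of_nat_mult exp_double[symmetric] ln_realpow[of 2 3, simplified, symmetric])
  finally have "5 ^ n * (exp (- (81/100) * t) * 2 powr (t / 2)) \<le> exp (real n * (3 * ln 2)) * (exp (- (81/100) * t) * exp (t / 2 * ln 2))"
    by (intro mult_mono) (auto simp: powr_def)
  also have "\<dots> = exp (real n * (3 * ln 2) - (81/100) * t + t / 2 * ln 2)"
    by (simp add: mult_exp_exp)
  also have "real n * (3 * ln 2) - (81/100) * t + t / 2 * ln 2 \<le> ln \<delta>"
  proof -
    have "real n * ln 2 \<le> real n * (25/36)" "t / 2 * ln 2 \<le> t / 2 * (25/36)"
      by (intro mult_left_mono ln2_le_25_over_36; simp)+
    then show ?thesis using t L ln2_ge_two_thirds by linarith
  qed
  finally show ?thesis using \<delta> by simp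
qed

lemma tail_probability_exp:
  fixes e s \<theta> \<delta> :: real and n t :: nat
  assumes "0 < e" "0 < s" "0 < \<delta>" and "n * ln ((1 + e) / e) + s * \<theta> * t - t / 2 * ln (1 + 2 * s) \<le> ln \<delta>"
  shows "((1 + e) / e) ^ n * (exp (s * \<theta> * t) * (1 + 2 * s) powr (- (t / 2))) \<le> \<delta>"
proof -
  have "((1 + e) / e) ^ n = exp (n * ln ((1 + e) / e))"
    using assms by (simp add: exp_of_nat_mult)
  then have "((1 + e) / e) ^ n * (exp (s * \<theta> * t) * (1 + 2 * s) powr (- (t / 2)))
    = exp (n * ln ((1 + e) / e) + s * \<theta> * t - t / 2 * ln (1 + 2 * s))"
    using assms by (simp add: powr_def mult_exp_exp)
  also have "\<dots> \<le> exp (ln \<delta>)" using assms by (intro iffD2[OF exp_le_cancel_iff])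
  finally show ?thesis using assms by simp
qed

text \<open>The ratio of volumes is \<open>101 + 100 * r\<close>, and the tangent to the logarithm
  at \<open>256 = 2 ^ 8\<close> gives a bound linear in \<open>r\<close>. The radius shrinks with
  \<open>r\<close> because large means enlarge the design seminorm of small perturbations.\<close>

lemma ln_smoothing_radius:
  fixes r :: real
  assumes "0 \<le> r" and e: "e = 1 / (100 * (1 + r))"
  shows "ln ((1 + e) / e) \<le> 5 + r"
proof -
  have eq: "(1 + e) / e = 101 + 100 * r"
    using assms(1) unfolding e by (simp add: field_simps)
  have "ln ((101 + 100 * r) / 256) \<le> (101 + 100 * r) / 256 - 1"
    using assms by (intro ln_le_minus_one) auto
  moreover have "ln ((101 + 100 * r) / 256) = ln (101 + 100 * r) - 8 * ln 2"
    using assms ln_realpow[of 2 8] by (simp add: ln_div)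
  ultimately have "ln (101 + 100 * r) - 8 * ln 2 \<le> (101 + 100 * r) / 256 - 1"
    by metis
  also have "\<dots> = 101/256 - 1 + 100/256 * r"
    by (simp add: field_simps)
  finally show ?thesis
    unfolding eq using ln2_le_25_over_36 assms(1) by simp
qed

text \<open>With about eight observations per dimension a large tilt \<open>s = 4\<close> is used:
  \<open>ln 9 \<ge> 2\<close> gains \<open>t\<close> against the costs \<open>4/25 * t\<close> and
  \<open>11/2\<close> per dimension.\<close>

lemma tail_failure_probability_small_mean:
  fixes \<delta> r e :: real and n t :: nat
  assumes \<delta>: "0 < \<delta>" "\<delta> < 1/4" and t: "8 * real n + 16 * ln (2 / \<delta>) \<le> real t"
    and r: "0 \<le> r" "r \<le> 1/2" and e: "e = 1 / (100 * (1 + r))"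
  shows "((1 + e) / e) ^ n * (exp (4 * (1/25) * t) * (1 + 2 * 4) powr (- (t / 2))) \<le> \<delta>"
proof (rule tail_probability_exp)
  have L: "ln (2 / \<delta>) = ln 2 - ln \<delta>" "ln \<delta> \<le> 0"
    using \<delta> by (auto simp: ln_div)
  have "real n * ln ((1 + e) / e) \<le> real n * (11/2)"
    using ln_smoothing_radius[OF r(1) e] r by (intro mult_left_mono) auto
  moreover have "2 \<le> ln (1 + 2 * 4 :: real)"
  proof -
    have "2 \<le> 3 * ln (2::real)" using ln2_ge_two_thirds by simp
    also have "\<dots> = ln (2 ^ 3)" by (subst ln_realpow) auto
    also have "\<dots> \<le> ln (1 + 2 * 4)" by simp
    finally show ?thesis .
  qed
  then have "t / 2 * 2 \<le> t / 2 * ln (1 + 2 * 4 :: real)" by (intro mult_left_mono) auto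
  ultimately show "n * ln ((1 + e) / e) + 4 * (1/25) * t - t / 2 * ln (1 + 2 * 4) \<le> ln \<delta>"
    using t L ln2_ge_two_thirds by linarith
qed (use r e \<delta> in auto)

text \<open>For \<open>s = 1/3\<close>, the value \<open>\<theta> = 3/5\<close> is the largest with
  \<open>\<theta> * (1 + 2 * s) \<le> 1\<close>. The net gain is only \<open>t / 20\<close>, which
  suffices since \<open>t\<close> is at least \<open>1024 * r\<^sup>2\<close> per dimension.\<close>

lemma tail_failure_probability_large_mean:
  fixes \<delta> r e :: real and n t :: nat
  assumes \<delta>: "0 < \<delta>" "\<delta> < 1/4" and t: "(16 * r * (sqrt (4 * real n) + sqrt (2 * ln (2 / \<delta>))))\<^sup>2 \<le> real t"
    and r: "1/2 \<le> r" and e: "e = 1 / (100 * (1 + r))"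
  shows "((1 + e) / e) ^ n * (exp (1/3 * (3/5) * t) * (1 + 2 * (1/3)) powr (- (t / 2))) \<le> \<delta>"
proof (rule tail_probability_exp)
  define L' where "L' = ln (2 / \<delta>)"
  have L: "L' = ln 2 - ln \<delta>" "ln \<delta> \<le> 0"
    using \<delta> by (auto simp: ln_div L'_def)
  then have L'0: "L' \<ge> 0" using ln2_ge_two_thirds by simp
  have "4 * real n + 2 * L' \<le> (sqrt (4 * real n) + sqrt (2 * L'))\<^sup>2"
    using L'0 by (simp add: power2_sum)
  then have "256 * r\<^sup>2 * (4 * real n + 2 * L') \<le> 256 * r\<^sup>2 * (sqrt (4 * real n) + sqrt (2 * L'))\<^sup>2"
    by (intro mult_left_mono) auto
  also have "\<dots> \<le> real t"
    using t by (simp add: power_mult_distrib L'_def)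
  finally have t': "256 * r\<^sup>2 * (4 * real n + 2 * L') \<le> real t" .
  have r2: "1/4 \<le> r\<^sup>2" "r \<le> 2 * r\<^sup>2"
    using power_mono[OF r, of 2] mult_right_mono[OF r, of r] r by (auto simp: power2_eq_square)
  \<comment> \<open>Since \<open>1/2 \<le> r\<close>, both \<open>5 \<le> 20 * r\<^sup>2\<close> and
    \<open>r \<le> 2 * r\<^sup>2\<close>, so the volume cost is quadratic in \<open>r\<close> like
    the lower bound on \<open>t\<close>.\<close>
  have "real n * ln ((1 + e) / e) \<le> real n * (50 * r\<^sup>2)"
    using ln_smoothing_radius[OF _ e] r r2 by (intro mult_left_mono) auto
  \<comment> \<open>The base is \<open>5/3\<close>, whose logarithm is at least \<open>1/2\<close>:
    a gain of \<open>t / 4\<close> against the cost \<open>t / 5\<close>.\<close>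
  moreover have "1/2 \<le> ln (1 + 2 * (1/3) :: real)"
    using exp_half_le by (subst ln_ge_iff) auto
  then have "t / 2 * (1/2) \<le> t / 2 * ln (1 + 2 * (1/3) :: real)" by (intro mult_left_mono) auto
  moreover have "1/4 * L' \<le> r\<^sup>2 * L'"
    using r2 L'0 by (intro mult_right_mono) auto
  ultimately show "n * ln ((1 + e) / e) + 1/3 * (3/5) * t - t / 2 * ln (1 + 2 * (1/3)) \<le> ln \<delta>"
    using t' L ln2_ge_two_thirds by (simp add: algebra_simps)
qed (use r e \<delta> in auto)

text \<open>
  Chosen so that the failure probability of the volume bound with radius \<open>1/7\<close>, for which the ratio of
  volumes is \<open>8\<^sup>n\<close>, is exactly \<open>\<delta>\<close>.
\<close>
definition noise_level :: "nat \<Rightarrow> nat \<Rightarrow> real \<Rightarrow> real" where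
  "noise_level n l \<delta> = sqrt (64/9 * ((3 * real n + real l / 2) * ln 2 + ln (1 / \<delta>)))"

lemma noise_failure_probability:
  assumes "0 < \<delta>" "\<delta> < 1"
  shows "8 ^ n * (exp (- (9/64) * (noise_level n l \<delta>)\<^sup>2) * 2 powr (l / 2)) = \<delta>"
proof -
  have "0 \<le> (3 * real n + real l / 2) * ln 2 + ln (1 / \<delta>)"
    using assms by simp
  then have "(noise_level n l \<delta>)\<^sup>2 = 64/9 * ((3 * real n + real l / 2) * ln 2 + ln (1 / \<delta>))"
    unfolding noise_level_def by (intro real_sqrt_pow2) simp
  moreover have "ln (1 / \<delta>) = - ln \<delta>"
    using assms by (simp add: ln_div)
  moreover have "(8::real) ^ n = exp (real n * (3 * ln 2))"
    by (simp add: exp_of_nat_mult exp_double[symmetric] ln_realpow[of 2 3, simplified, symmetric])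
  moreover from calculation have "real n * (3 * ln 2) + (- (9/64) * (noise_level n l \<delta>)\<^sup>2 + l / 2 * ln 2) = ln \<delta>"
    by (simp add: algebra_simps)
  ultimately show ?thesis
    using assms by (simp add: powr_def mult_exp_exp)
qed

section \<open>Deterministic lower bound for the design seminorm\<close>

lemma design_norm_le_deviation:
  "design_norm J X v \<le> design_norm J (\<lambda>j. X j - \<mu> j) v + design_norm J \<mu> v"
  using L2_set_triangle_ineq[of "\<lambda>j. (X j - \<mu> j) \<bullet> v" "\<lambda>j. \<mu> j \<bullet> v" J]
  by (simp add: design_norm_def inner_diff_left)

lemma design_norm_bounded_rows:
  assumes "\<And>j. j \<in> J \<Longrightarrow> norm (\<mu> j) \<le> c" and "c \<ge> 0"
  shows "design_norm J \<mu> v \<le> c * sqrt (card J) * norm v"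
proof -
  have "(\<mu> j \<bullet> v)\<^sup>2 \<le> (c * norm v)\<^sup>2" if "j \<in> J" for j
  proof -
    have "\<bar>\<mu> j \<bullet> v\<bar> \<le> c * norm v"
      using Cauchy_Schwarz_ineq2[of "\<mu> j" v] mult_right_mono[OF assms(1)[OF that], of "norm v"] by simp
    then show ?thesis
      using abs_le_square_iff[of "\<mu> j \<bullet> v" "c * norm v"] \<open>c \<ge> 0\<close> by simp
  qed
  then have "(design_norm J \<mu> v)\<^sup>2 \<le> (\<Sum>j\<in>J. (c * norm v)\<^sup>2)"
    unfolding design_norm_square by (intro sum_mono)
  also have "\<dots> = (c * sqrt (card J) * norm v)\<^sup>2"
    by (simp add: power_mult_distrib)
  finally show ?thesis
    by (rule power2_le_imp_le) (use \<open>c \<ge> 0\<close> in simp)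
qed

text \<open>The triangle inequality transfers the estimate from the good \<open>v\<close> to
  \<open>v0\<close>: the seminorm of \<open>v - v0\<close> is at most \<open>e * (3 + r)\<close> in
  units of \<open>sqrt (card J) * \<sigma>\<close>, with \<open>3\<close> from the deviation and
  \<open>r\<close> from the means. The passage from \<open>sqrt \<theta>\<close> to
  \<open>\<rho>\<close> pays for this, and homogeneity extends the bound to all
  \<open>z\<close>.\<close>

lemma design_lower_bound:
  fixes X \<mu> :: "nat \<Rightarrow> real^'n" and \<sigma> r \<theta> m e \<rho> :: real
  assumes dev: "\<And>v. design_norm J (\<lambda>j. X j - \<mu> j) v \<le> 3 * sqrt (card J) * \<sigma> * norm v"
    and mean: "\<And>j. j \<in> J \<Longrightarrow> norm (\<mu> j) \<le> r * \<sigma>" and "0 \<le> r" "0 < \<sigma>" "0 \<le> \<theta>" "0 \<le> m"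
    and tail: "\<And>v0. norm v0 = 1 \<Longrightarrow>
      \<exists>v. norm (v - v0) \<le> e \<and> sqrt (\<theta> * card J * (1 + m)) * \<sigma> * norm v < design_norm J X v"
    and \<rho>: "\<rho> + e * (3 + r) \<le> sqrt \<theta> * (1 - e)"
  shows "\<rho> * sqrt (card J * (1 + m)) * \<sigma> * norm z \<le> design_norm J X z"
proof (cases "z = 0")
  case True
  then show ?thesis by (simp add: design_norm_nonneg)
next
  case False
  define v0 where "v0 = (1 / norm z) *\<^sub>R z"
  have v0: "norm v0 = 1" and z: "z = norm z *\<^sub>R v0"
    using False by (auto simp: v0_def)
  obtain v where v: "norm (v - v0) \<le> e" and low: "sqrt (\<theta> * card J * (1 + m)) * \<sigma> * norm v < design_norm J X v"
    using tail[OF v0] by blast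
  define S where "S = sqrt (card J * (1 + m)) * \<sigma>"
  have S0: "S \<ge> 0" using assms by (simp add: S_def)
  \<comment> \<open>As \<open>1 + m \<ge> 1\<close>, the loss can be expressed in the larger unit
    \<open>S\<close> of the main term.\<close>
  have tS: "sqrt (card J) * \<sigma> \<le> S"
    unfolding S_def using \<open>0 < \<sigma>\<close> mult_left_mono[of 1 "1 + m" "real (card J)"] \<open>0 \<le> m\<close>
    by (intro mult_right_mono real_sqrt_le_mono) auto
  have "1 - e \<le> norm v"
    using norm_triangle_ineq2[of v0 "v0 - v"] v v0 by (simp add: norm_minus_commute)
  then have "sqrt \<theta> * S * (1 - e) \<le> sqrt \<theta> * S * norm v"
    using S0 assms by (intro mult_left_mono) auto
  also have "\<dots> = sqrt (\<theta> * card J * (1 + m)) * \<sigma> * norm v"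
    by (simp add: S_def real_sqrt_mult mult_ac)
  also have "\<dots> \<le> design_norm J X v" using low by simp
  also have "\<dots> \<le> design_norm J X v0 + design_norm J X (v - v0)"
    using design_norm_triangle[of J X v0 "v - v0"] by simp
  also have "design_norm J X (v - v0) \<le> 3 * sqrt (card J) * \<sigma> * norm (v - v0) + r * \<sigma> * sqrt (card J) * norm (v - v0)"
    using design_norm_le_deviation[of J X "v - v0" \<mu>] dev[of "v - v0"] design_norm_bounded_rows[of J \<mu> "r * \<sigma>" "v - v0"] mean assms(3,4)
    by fastforce
  also have "\<dots> = (3 + r) * (sqrt (card J) * \<sigma>) * norm (v - v0)"
    by (simp add: algebra_simps)
  also have "\<dots> \<le> (3 + r) * S * e"
    using tS v assms S0 by (intro mult_mono) auto
  finally have "(sqrt \<theta> * (1 - e) - e * (3 + r)) * S \<le> design_norm J X v0"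
    by (simp add: algebra_simps)
  moreover have "\<rho> * S \<le> (sqrt \<theta> * (1 - e) - e * (3 + r)) * S"
    using \<rho> S0 by (intro mult_right_mono) auto
  ultimately have "norm z * (\<rho> * S) \<le> norm z * design_norm J X v0"
    by (intro mult_left_mono) auto
  also have "\<dots> = design_norm J X z"
    by (subst (2) z) (simp add: design_norm_scaleR)
  finally show ?thesis by (simp add: S_def mult_ac)
qed

section \<open>Smallest eigenvalue of the shifted Gram matrix of the means\<close>

lemma shifted_gram_matrix:
  fixes \<mu> :: "nat \<Rightarrow> real^'n" and J :: "nat set"
  defines "A c \<equiv> mat 1 + c *\<^sub>R (\<Sum>j\<in>J. outer (\<mu> j) (\<mu> j))"
  shows "transpose (A c) = A c" "u \<bullet> (A c *v u) = u \<bullet> u + c * (\<Sum>j\<in>J. (\<mu> j \<bullet> u)\<^sup>2)"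
proof -
  show "transpose (A c) = A c"
    by (simp add: A_def vec_eq_iff transpose_def mat_def outer_def mult.commute eq_commute)
  show "u \<bullet> (A c *v u) = u \<bullet> u + c * (\<Sum>j\<in>J. (\<mu> j \<bullet> u)\<^sup>2)"
    by (simp add: A_def matrix_vector_mult_add_rdistrib scaleR_matrix_vector_assoc[symmetric] sum_matrix_vec
        outer_mult_vec inner_add_right inner_sum_right power2_eq_square inner_commute)
qed

text \<open>The matrix dominates the identity, so its smallest eigenvalue is a Rayleigh minimum.
  Summing the second claim over the coordinate axes compares it with the trace and gives the
  third.\<close>

lemma lambda_min_shifted_gram:
  fixes \<mu> :: "nat \<Rightarrow> real^'n" and J :: "nat set" and c :: real
  assumes "c \<ge> 0"
  defines "\<kappa> \<equiv> lambda_min (mat 1 + c *\<^sub>R (\<Sum>j\<in>J. outer (\<mu> j) (\<mu> j)))"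
  shows "1 \<le> \<kappa>" "(\<kappa> - 1) * (norm u)\<^sup>2 \<le> c * (\<Sum>j\<in>J. (\<mu> j \<bullet> u)\<^sup>2)"
    "real CARD('n) * (\<kappa> - 1) \<le> c * (\<Sum>j\<in>J. (norm (\<mu> j))\<^sup>2)"
proof -
  have pd: "1 * (u \<bullet> u) \<le> u \<bullet> ((mat 1 + c *\<^sub>R (\<Sum>j\<in>J. outer (\<mu> j) (\<mu> j))) *v u)" for u
    using \<open>c \<ge> 0\<close> unfolding shifted_gram_matrix by (simp add: sum_nonneg)
  note lm = lambda_min_positive_definite[OF shifted_gram_matrix(1) zero_less_one pd, folded \<kappa>_def]
  show "1 \<le> \<kappa>" by (rule lm(1))
  have *: "(\<kappa> - 1) * (norm u)\<^sup>2 \<le> c * (\<Sum>j\<in>J. (\<mu> j \<bullet> u)\<^sup>2)" for u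
    using lm(2)[of u] unfolding shifted_gram_matrix by (simp add: algebra_simps power2_norm_eq_inner)
  then show "(\<kappa> - 1) * (norm u)\<^sup>2 \<le> c * (\<Sum>j\<in>J. (\<mu> j \<bullet> u)\<^sup>2)" .
  have "real CARD('n) * (\<kappa> - 1) = (\<Sum>k\<in>(UNIV::'n set). (\<kappa> - 1) * (norm (axis k (1::real)))\<^sup>2)"
    by simp
  also have "\<dots> \<le> (\<Sum>k\<in>UNIV. c * (\<Sum>j\<in>J. (\<mu> j \<bullet> axis k 1)\<^sup>2))"
    by (intro sum_mono *)
  also have "\<dots> = c * (\<Sum>j\<in>J. \<Sum>k\<in>UNIV. (\<mu> j $ k)\<^sup>2)"
    by (subst sum.swap) (simp add: sum_distrib_left inner_axis)
  also have "\<dots> = c * (\<Sum>j\<in>J. (norm (\<mu> j))\<^sup>2)"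
    unfolding power2_norm_eq_inner by (simp add: inner_vec_def power2_eq_square)
  finally show "real CARD('n) * (\<kappa> - 1) \<le> c * (\<Sum>j\<in>J. (norm (\<mu> j))\<^sup>2)" .
qed

section \<open>Comparison of the noise level with the two summands of the constant\<close>

lemma noise_level_le:
  assumes "0 < \<delta>" "\<delta> < 1" "1 \<le> n" "1 \<le> l"
  shows "noise_level n l \<delta> \<le> 8/3 * sqrt ((real n + real l) * ln (9 / \<delta>))"
proof -
  \<comment> \<open>The dimension terms fit because \<open>ln 8 \<le> ln 9\<close>; the term
    \<open>- ln \<delta>\<close> fits because \<open>n + l \<ge> 1\<close>. The outer factor
    \<open>64/9\<close> is \<open>(8/3)\<^sup>2\<close>.\<close>
  have "3 * ln 2 = ln (2 ^ 3 :: real)" by (subst ln_realpow) auto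
  also have "\<dots> \<le> ln 9" by simp
  finally have "3 * ln 2 \<le> ln (9::real)" .
  then have n2: "real n * (3 * ln 2) \<le> real n * ln 9" and "real l * (3 * ln 2) \<le> real l * ln 9"
    by (auto intro: mult_left_mono)
  then have l2: "3 * (real l * ln 2) \<le> real l * ln 9" by (simp add: mult_ac)
  have "1 * (- ln \<delta>) \<le> (real n + real l) * (- ln \<delta>)"
    using assms by (intro mult_right_mono) auto
  moreover have "(3 * real n + real l / 2) * ln 2 = real n * (3 * ln 2) + (real l * ln 2) / 2"
    by (simp add: algebra_simps)
  moreover have "0 \<le> real l * ln 2" by simp
  moreover have "(real n + real l) * (ln 9 - ln \<delta>) = real n * ln 9 + real l * ln 9 + (real n + real l) * (- ln \<delta>)"
    by (simp add: algebra_simps)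
  ultimately have "(3 * real n + real l / 2) * ln 2 + (- ln \<delta>) \<le> (real n + real l) * (ln 9 - ln \<delta>)"
    using n2 l2 by linarith
  moreover have "ln (1 / \<delta>) = - ln \<delta>" "ln (9 / \<delta>) = ln 9 - ln \<delta>"
    using assms by (simp_all add: ln_div)
  ultimately have "(3 * real n + real l / 2) * ln 2 + ln (1 / \<delta>) \<le> (real n + real l) * ln (9 / \<delta>)"
    by simp
  then have "64/9 * ((3 * real n + real l / 2) * ln 2 + ln (1 / \<delta>)) \<le> 64/9 * ((real n + real l) * ln (9 / \<delta>))"
    by simp
  then have "noise_level n l \<delta> \<le> sqrt (64/9 * ((real n + real l) * ln (9 / \<delta>)))"
    unfolding noise_level_def by (rule real_sqrt_le_mono)
  moreover have "sqrt (64/9) = (8/3 :: real)"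
    using real_sqrt_abs[of "8/3"] by (simp add: power2_eq_square)
  ultimately show ?thesis by (metis real_sqrt_mult)
qed

text \<open>Both sides are compared after squaring. \<open>\<delta> < 1/4\<close> gives
  \<open>L' \<ge> 2\<close>, so the cross term \<open>P\<close> is at least \<open>28/10\<close> and
  helps to pay for the \<open>3 * n\<close> in the noise level. The factor
  \<open>sqrt (2 * real n)\<close> is later compensated by the trace bound on the smallest
  eigenvalue.\<close>

lemma noise_level_le_mean_term:
  assumes \<delta>: "0 < \<delta>" "\<delta> < 1/4" and nl: "1 \<le> n" "1 \<le> l"
  shows "noise_level n l \<delta> \<le> sqrt (2 * real n) * (sqrt (2 * (real l + real n)) + 2 * sqrt (ln (2 / \<delta>)))"
proof -
  define L' where "L' = ln (2 / \<delta>)"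
  define P where "P = sqrt (2 * (real l + real n)) * sqrt L'"
  have L: "L' = ln 2 - ln \<delta>" using \<delta> by (simp add: L'_def ln_div)
  have "ln (8::real) = 3 * ln 2" using ln_realpow[of 2 3] by simp
  moreover have "ln 8 \<le> L'" using \<delta> by (simp add: L'_def field_simps)
  ultimately have L'2: "2 \<le> L'" using ln2_ge_two_thirds by simp
  have "2 * 2 * 2 \<le> 2 * (real l + real n) * L'"
    using L'2 nl by (intro mult_mono) auto
  then have "2 * sqrt 2 \<le> P"
    unfolding P_def real_sqrt_mult[symmetric] by (intro real_le_rsqrt) (simp add: power_mult_distrib)
  moreover have "(14/10)\<^sup>2 \<le> (2::real)" by (simp add: power2_eq_square)
  then have "14/10 \<le> sqrt 2" by (rule real_le_rsqrt)
  ultimately have P: "28/10 \<le> P" by simp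
  have b2: "(sqrt (2 * (real l + real n)) + 2 * sqrt L')\<^sup>2 = 2 * (real l + real n) + 4 * L' + 4 * P"
    using L'2 by (simp add: power2_sum power_mult_distrib P_def)
  have "64/9 * ((3 * real n + real l / 2) * ln 2 + ln (1 / \<delta>)) \<le> 64/9 * ((3 * real n + real l / 2) * (25/36) + L')"
    using \<delta> ln2_le_25_over_36 ln2_ge_two_thirds
    by (intro mult_left_mono add_mono) (auto simp: L ln_div)
  also have "\<dots> \<le> 2 * real n * (2 * (real l + real n) + 4 * L' + 4 * P)"
  proof -
    have "1 * (real l + real n) \<le> real n * (real l + real n)" "1 * L' \<le> real n * L'" "real n * (28/10) \<le> real n * P"
      using nl P L'2 by (intro mult_mono; simp)+
    then show ?thesis using L'2 by (simp only: algebra_simps)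
  qed
  also have "\<dots> = (sqrt (2 * real n) * (sqrt (2 * (real l + real n)) + 2 * sqrt L'))\<^sup>2"
    unfolding power_mult_distrib b2 by simp
  finally have "noise_level n l \<delta> \<le> sqrt ((sqrt (2 * real n) * (sqrt (2 * (real l + real n)) + 2 * sqrt L'))\<^sup>2)"
    unfolding noise_level_def by (rule real_sqrt_le_mono)
  then show ?thesis using L'2 by (simp add: L'_def)
qed

text \<open>For \<open>r \<le> 1/2\<close> the trace bound gives \<open>\<kappa> \<le> 2\<close>,
  and \<open>2 * (8/3 * a)\<close> equals the \<open>a\<close>-part \<open>32/6 * a\<close> of the
  right-hand side.\<close>

lemma error_bound_small_mean:
  assumes g: "0 \<le> g" "g \<le> 8/3 * a" and r: "0 \<le> r" "r \<le> 1/2" and b: "0 \<le> b" and n: "1 \<le> n" and "1 \<le> \<kappa>" and \<kappa>: "real n * (\<kappa> - 1) \<le> 4 * r\<^sup>2"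
  shows "g * \<kappa> \<le> 1/6 * (8 * (4 * a + r * b))"
proof -
  have "1 * (\<kappa> - 1) \<le> real n * (\<kappa> - 1)" using n \<open>1 \<le> \<kappa>\<close> by (intro mult_right_mono) auto
  moreover have "r\<^sup>2 \<le> (1/2)\<^sup>2" using r by (intro power_mono) auto
  ultimately have "\<kappa> \<le> 2" using \<kappa> by (simp add: power2_eq_square)
  then have "g * \<kappa> \<le> g * 2" using g by (intro mult_left_mono)
  moreover have "0 \<le> r * b" using r b by simp
  ultimately show ?thesis using g by simp
qed

text \<open>With \<open>\<kappa> = 1 + 4 * q\<^sup>2\<close>, the inequality
  \<open>1 + 4 * q\<^sup>2 \<le> sqrt (1 + q\<^sup>2) * (1 + 4 * q)\<close> splits off the gain from
  the means. Of the rest, \<open>g\<close> is covered by the \<open>a\<close>-part and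
  \<open>4 * g * q\<close> by \<open>r * b\<close>, using
  \<open>sqrt (real n) * q \<le> r\<close>.\<close>

lemma error_bound_large_mean:
  assumes g: "0 \<le> g" "g \<le> 8/3 * a" "g \<le> sqrt (2 * real n) * b" and r: "0 \<le> r" and b: "0 \<le> b" and n: "1 \<le> n"
    and "1 \<le> \<kappa>" and \<kappa>: "real n * (\<kappa> - 1) \<le> 4 * r\<^sup>2"
  shows "g * \<kappa> \<le> sqrt (1/2) * sqrt (1 + (\<kappa> - 1) / 4) * (8 * (4 * a + r * b))"
proof -
  define q where "q = sqrt ((\<kappa> - 1) / 4)"
  have q0: "0 \<le> q" and q2: "q\<^sup>2 = (\<kappa> - 1) / 4" using \<open>1 \<le> \<kappa>\<close> by (auto simp: q_def)
  have lam: "\<kappa> = 1 + 4 * q\<^sup>2" using q2 by simp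
  have "(1 + 4 * q\<^sup>2)\<^sup>2 \<le> (sqrt (1 + q\<^sup>2) * (1 + 4 * q))\<^sup>2"
  proof -
    have "(1 + q\<^sup>2) * (1 + 4 * q)\<^sup>2 - (1 + 4 * q\<^sup>2)\<^sup>2 = 8 * q + 9 * q\<^sup>2 + 8 * q ^ 3"
      by (simp add: power2_eq_square power3_eq_cube algebra_simps)
    also have "\<dots> \<ge> 0" using q0 by simp
    finally show ?thesis by (simp add: power_mult_distrib)
  qed
  then have 1: "1 + 4 * q\<^sup>2 \<le> sqrt (1 + q\<^sup>2) * (1 + 4 * q)"
    by (rule power2_le_imp_le) (use q0 in auto)
  have "sqrt (real n) * q \<le> r"
  proof -
    have "(sqrt (real n) * q)\<^sup>2 \<le> r\<^sup>2"
      using \<kappa> by (simp add: power_mult_distrib q2)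
    then show ?thesis by (rule power2_le_imp_le) (rule r)
  qed
  have "g * q \<le> (sqrt (2 * real n) * b) * q"
    using g q0 by (intro mult_right_mono) auto
  also have "\<dots> = sqrt 2 * b * (sqrt (real n) * q)" by (simp add: real_sqrt_mult)
  also have "\<dots> \<le> sqrt 2 * b * r"
    using \<open>sqrt (real n) * q \<le> r\<close> b by (intro mult_left_mono) auto
  finally have "g * q \<le> sqrt 2 * b * r" .
  then have "sqrt 2 * (g * q) \<le> sqrt 2 * (sqrt 2 * b * r)" by (intro mult_left_mono) auto
  then have 2: "sqrt 2 * (g * q) \<le> 2 * (b * r)" by (simp add: mult.assoc[symmetric])
  have "sqrt 2 * g \<le> 2 * g" using g real_sqrt_le_mono[of 2 4] by (intro mult_right_mono) auto
  then have 3: "sqrt 2 * (g * (1 + 4 * q)) \<le> 8 * (4 * a + r * b)"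
    using 2 g by (simp add: algebra_simps)
  have "sqrt (1/2) * (sqrt 2 * (g * (1 + 4 * q))) = g * (1 + 4 * q)"
    by (simp add: real_sqrt_divide)
  then have "g * (1 + 4 * q) \<le> sqrt (1/2) * (8 * (4 * a + r * b))"
    using mult_left_mono[OF 3, of "sqrt (1/2)"] by (simp only: real_sqrt_ge_zero)
  then have "sqrt (1 + q\<^sup>2) * (g * (1 + 4 * q)) \<le> sqrt (1 + q\<^sup>2) * (sqrt (1/2) * (8 * (4 * a + r * b)))"
    by (intro mult_left_mono) auto
  moreover have "g * \<kappa> \<le> g * (sqrt (1 + q\<^sup>2) * (1 + 4 * q))"
    unfolding lam using 1 g by (intro mult_left_mono)
  ultimately show ?thesis by (simp add: q2 mult_ac)
qed

subsection \<open>Measurability and conditioning on the design\<close>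

lemma borel_measurable_least_squares_error:
  fixes X :: "nat \<Rightarrow> 'a \<Rightarrow> real^'n" and Y :: "nat \<Rightarrow> 'a \<Rightarrow> real^'l" and Theta :: "real^'n^'l"
  assumes "\<And>j. j \<in> J \<Longrightarrow> X j \<in> borel_measurable M" "\<And>j. j \<in> J \<Longrightarrow> Y j \<in> borel_measurable M"
  shows "{\<omega>\<in>space M. spec_norm ((\<Sum>j\<in>J. outer (Y j \<omega>) (X j \<omega>)) ** pinv (\<Sum>j\<in>J. outer (X j \<omega>) (X j \<omega>)) - Theta) \<le> c} \<in> sets M"
proof -
  have outer: "(\<lambda>\<omega>. outer (f \<omega>) (g \<omega>)) \<in> borel_measurable M"
    if "f \<in> borel_measurable M" "g \<in> borel_measurable M" for f :: "'a \<Rightarrow> real^'p" and g :: "'a \<Rightarrow> real^'q"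
    using that by (rule borel_measurable_continuous_Pair) (intro continuous_on_outer continuous_intros)
  have "(\<lambda>\<omega>. \<Sum>j\<in>J. outer (Y j \<omega>) (X j \<omega>)) \<in> borel_measurable M"
    by (intro borel_measurable_sum outer assms)
  moreover have "(\<lambda>\<omega>. pinv (\<Sum>j\<in>J. outer (X j \<omega>) (X j \<omega>))) \<in> borel_measurable M"
    by (intro measurable_compose[OF _ borel_measurable_pinv] borel_measurable_sum outer assms)
  ultimately have "(\<lambda>\<omega>. (\<Sum>j\<in>J. outer (Y j \<omega>) (X j \<omega>)) ** pinv (\<Sum>j\<in>J. outer (X j \<omega>) (X j \<omega>))) \<in> borel_measurable M"
    by (rule borel_measurable_continuous_Pair) (intro continuous_on_matrix_mult continuous_intros)
  then have "(\<lambda>\<omega>. (\<Sum>j\<in>J. outer (Y j \<omega>) (X j \<omega>)) ** pinv (\<Sum>j\<in>J. outer (X j \<omega>) (X j \<omega>)) - Theta) \<in> borel_measurable M"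
    by measurable
  from measurable_sets[OF this borel_closed[OF closed_spec_norm_le[of c]]]
  show ?thesis by (simp add: vimage_def Int_def conj_commute)
qed

text \<open>The condition over uncountably many \<open>v\<close> says that the Gram matrix lies in a
  closed set of matrices.\<close>

lemma design_norm_lower_measurable:
  fixes X :: "nat \<Rightarrow> 'a \<Rightarrow> real^'n"
  assumes "\<And>j. j \<in> J \<Longrightarrow> X j \<in> borel_measurable M" and "c \<ge> 0"
  shows "{\<omega>\<in>space M. \<forall>v. c * norm v \<le> design_norm J (\<lambda>j. X j \<omega>) v} \<in> sets M"
proof -
  have outer: "(\<lambda>\<omega>. outer (X j \<omega>) (X j \<omega>)) \<in> borel_measurable M" if "j \<in> J" for j
    using assms(1)[OF that] assms(1)[OF that]
    by (rule borel_measurable_continuous_Pair) (intro continuous_on_outer continuous_intros)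
  have *: "(c * norm v \<le> design_norm J (\<lambda>j. X j \<omega>) v) \<longleftrightarrow> c\<^sup>2 * (v \<bullet> v) \<le> v \<bullet> ((\<Sum>j\<in>J. outer (X j \<omega>) (X j \<omega>)) *v v)" for \<omega> v
  proof -
    have "v \<bullet> ((\<Sum>j\<in>J. outer (X j \<omega>) (X j \<omega>)) *v v) = (design_norm J (\<lambda>j. X j \<omega>) v)\<^sup>2"
      unfolding design_norm_square
      by (simp add: sum_matrix_vec outer_mult_vec inner_sum_right power2_eq_square inner_commute)
    then show ?thesis
      using abs_le_square_iff[of "c * norm v" "design_norm J (\<lambda>j. X j \<omega>) v"] \<open>c \<ge> 0\<close>
      by (simp add: power_mult_distrib power2_norm_eq_inner design_norm_nonneg)
  qed
  have "closed {V :: real^'n^'n. \<forall>v. c\<^sup>2 * (v \<bullet> v) \<le> v \<bullet> (V *v v)}"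
    unfolding matrix_vector_mult_def by (intro closed_Collect_all closed_Collect_le continuous_intros)
  moreover have "(\<lambda>\<omega>. \<Sum>j\<in>J. outer (X j \<omega>) (X j \<omega>)) \<in> borel_measurable M"
    by (intro borel_measurable_sum outer)
  ultimately have "(\<lambda>\<omega>. \<Sum>j\<in>J. outer (X j \<omega>) (X j \<omega>)) -` {V. \<forall>v. c\<^sup>2 * (v \<bullet> v) \<le> v \<bullet> (V *v v)} \<inter> space M \<in> sets M"
    by (intro measurable_sets) (auto intro: borel_closed)
  then show ?thesis
    by (simp add: * vimage_def Int_def conj_commute)
qed

text \<open>Under independence the joint law is a product, so the probability of \<open>H\<close>
  averages those of its sections. Conditioning on \<open>X\<close> reduces to freezing its
  value.\<close>

lemma (in prob_space) emeasure_indep_section_bound: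
  assumes "indep_var S X T Y" and H: "H \<in> sets (S \<Otimes>\<^sub>M T)"
    and sec: "\<And>\<xi>. \<xi> \<in> space S \<Longrightarrow> emeasure M {\<omega>\<in>space M. (\<xi>, Y \<omega>) \<in> H} \<le> c"
  shows "emeasure M {\<omega>\<in>space M. (X \<omega>, Y \<omega>) \<in> H} \<le> c"
proof -
  have X: "X \<in> M \<rightarrow>\<^sub>M S" and Y: "Y \<in> M \<rightarrow>\<^sub>M T"
    and eq: "distr M S X \<Otimes>\<^sub>M distr M T Y = distr M (S \<Otimes>\<^sub>M T) (\<lambda>\<omega>. (X \<omega>, Y \<omega>))"
    using assms(1) by (auto simp: indep_var_distribution_eq)
  interpret X: prob_space "distr M S X" by (rule prob_space_distr[OF X])
  interpret Y: prob_space "distr M T Y" by (rule prob_space_distr[OF Y])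
  have H': "H \<in> sets (distr M S X \<Otimes>\<^sub>M distr M T Y)"
    using H by (simp cong: sets_pair_measure_cong)
  have "emeasure M {\<omega>\<in>space M. (X \<omega>, Y \<omega>) \<in> H} = emeasure (distr M (S \<Otimes>\<^sub>M T) (\<lambda>\<omega>. (X \<omega>, Y \<omega>))) H"
    using X Y H by (subst emeasure_distr) (auto simp: vimage_def Int_def conj_commute)
  also have "\<dots> = (\<integral>\<^sup>+\<xi>. emeasure (distr M T Y) (Pair \<xi> -` H) \<partial>distr M S X)"
    unfolding eq[symmetric] by (rule Y.emeasure_pair_measure_alt[OF H'])
  also have "\<dots> \<le> (\<integral>\<^sup>+\<xi>. c \<partial>distr M S X)"
  proof (rule nn_integral_mono)
    fix \<xi> assume "\<xi> \<in> space (distr M S X)"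
    then have "\<xi> \<in> space S" by simp
    moreover have "Pair \<xi> -` H \<in> sets T" by (rule sets_Pair1[OF H])
    ultimately show "emeasure (distr M T Y) (Pair \<xi> -` H) \<le> c"
      using sec[of \<xi>] Y by (subst emeasure_distr) (auto simp: vimage_def Int_def conj_commute)
  qed
  also have "\<dots> = c" using X.emeasure_space_1 by simp
  finally show ?thesis .
qed

lemma borel_measurable_matrix_vector_mult:
  fixes A :: "real^'n^'m"
  shows "f \<in> borel_measurable M \<Longrightarrow> (\<lambda>\<omega>. A *v f \<omega>) \<in> borel_measurable M"
  by (rule measurable_compose[OF _ borel_measurable_continuous_onI])
     (auto intro: linear_continuous_on matrix_vector_mul_bounded_linear)

lemma (in prob_space) indep_vars_reindex_inj:
  assumes "indep_vars N Z I" and "inj_on f K" "f ` K \<subseteq> I"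
  shows "indep_vars (\<lambda>k. N (f k)) (\<lambda>k. Z (f k)) K"
proof -
  have "indep_vars (\<lambda>k. PiM {f k} N) (\<lambda>k \<omega>. restrict (\<lambda>i. Z i \<omega>) {f k}) K"
    using assms by (intro indep_vars_restrict[OF assms(1)]) (auto simp: disjoint_family_on_def inj_on_def)
  then have "indep_vars (\<lambda>k. N (f k)) (\<lambda>k \<omega>. (restrict (\<lambda>i. Z i \<omega>) {f k}) (f k)) K"
    by (rule indep_vars_compose2[where Y = "\<lambda>k h. h (f k)"]) simp
  then show ?thesis by simp
qed

text \<open>For a frozen good design the noise bound fails with probability at most
  \<open>\<delta>\<close>, uniformly in the design, and sections average this. The lower bound on
  the design is part of the event, so bad designs have empty sections.\<close>

lemma (in prob_space) regression_error_on_good_designs: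
  fixes x :: "nat \<Rightarrow> 'a \<Rightarrow> real^'n" and \<eta> :: "nat \<Rightarrow> 'a \<Rightarrow> real^'l" and Theta :: "real^'n^'l"
  assumes J: "finite J"
    and ind: "indep_vars (\<lambda>_. borel) (\<lambda>i \<omega>. case i of Inl (j, k) \<Rightarrow> x j \<omega> $ k | Inr (j, k') \<Rightarrow> \<eta> j \<omega> $ k')
      ((J \<times> UNIV) <+> (J \<times> UNIV))"
    and \<eta>: "\<And>j k. j \<in> J \<Longrightarrow> distributed M lborel (\<lambda>\<omega>. \<eta> j \<omega> $ k) (normal_density 0 \<sigma>)"
    and \<sigma>: "0 < \<sigma>" and c: "0 < c" and \<delta>: "0 < \<delta>" "\<delta> < 1"
    and b: "noise_level CARD('n) CARD('l) \<delta> * \<sigma> / c \<le> b"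
  shows "emeasure M {\<omega>\<in>space M. (\<forall>v. c * norm v \<le> design_norm J (\<lambda>j. x j \<omega>) v) \<and>
    \<not> spec_norm ((\<Sum>j\<in>J. outer (Theta *v x j \<omega> + \<eta> j \<omega>) (x j \<omega>)) ** pinv (\<Sum>j\<in>J. outer (x j \<omega>) (x j \<omega>)) - Theta) \<le> b} \<le> ennreal \<delta>"
proof -
  define Z where "Z i \<omega> = (case i of Inl (j, k) \<Rightarrow> x j \<omega> $ k | Inr (j, k') \<Rightarrow> \<eta> j \<omega> $ k')" for i \<omega>
  define I1 I2 where "I1 = (Inl ` (J \<times> UNIV) :: ((nat \<times> 'n) + (nat \<times> 'l)) set)"
    and "I2 = (Inr ` (J \<times> UNIV) :: ((nat \<times> 'n) + (nat \<times> 'l)) set)"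
  define S T where "S = PiM I1 (\<lambda>_. borel :: real measure)" and "T = PiM I2 (\<lambda>_. borel :: real measure)"
  define X Y where "X \<omega> = restrict (\<lambda>i. Z i \<omega>) I1" and "Y \<omega> = restrict (\<lambda>i. Z i \<omega>) I2" for \<omega>
  have indZ: "indep_vars (\<lambda>_. borel) Z ((J \<times> UNIV) <+> (J \<times> UNIV))"
    using ind by (simp add: Z_def[abs_def])
  have XY: "indep_var S X T Y"
    unfolding S_def T_def X_def Y_def
    by (rule indep_var_restrict[OF indZ]) (auto simp: I1_def I2_def)
  then have Xm: "X \<in> M \<rightarrow>\<^sub>M S" and Ym: "Y \<in> M \<rightarrow>\<^sub>M T"
    by (auto simp: indep_var_distribution_eq)
  have ind\<eta>: "indep_vars (\<lambda>_. borel) (\<lambda>(j, k) \<omega>. \<eta> j \<omega> $ k) (J \<times> UNIV)"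
  proof -
    have "indep_vars (\<lambda>_. borel) (\<lambda>k. Z (Inr k)) (J \<times> UNIV)"
      by (rule indep_vars_reindex_inj[OF indZ]) auto
    then show ?thesis by (simp add: Z_def[abs_def] case_prod_unfold)
  qed
  \<comment> \<open>\<open>x'\<close> and \<open>\<eta>'\<close> decode coordinate functions back
    into vectors, so that the event becomes a set \<open>H\<close> in the product space.\<close>
  define x' where "x' f j = (\<chi> k. f (Inl (j, k)))" for f :: "(nat \<times> 'n) + (nat \<times> 'l) \<Rightarrow> real" and j
  define \<eta>' where "\<eta>' f j = (\<chi> k. f (Inr (j, k)))" for f :: "(nat \<times> 'n) + (nat \<times> 'l) \<Rightarrow> real" and j
  have x'X: "x' (X \<omega>) j = x j \<omega>" and \<eta>'Y: "\<eta>' (Y \<omega>) j = \<eta> j \<omega>" if "j \<in> J" for \<omega> j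
    using that by (auto simp: x'_def \<eta>'_def X_def Y_def I1_def I2_def Z_def vec_eq_iff)
  have x'm: "(\<lambda>z. x' (fst z) j) \<in> borel_measurable (S \<Otimes>\<^sub>M T)" if "j \<in> J" for j
    unfolding x'_def S_def
    by (intro borel_measurable_vecI, simp, rule measurable_compose[OF measurable_fst measurable_component_singleton])
       (use that in \<open>auto simp: I1_def\<close>)
  have \<eta>'m: "(\<lambda>z. \<eta>' (snd z) j) \<in> borel_measurable (S \<Otimes>\<^sub>M T)" if "j \<in> J" for j
    unfolding \<eta>'_def T_def
    by (intro borel_measurable_vecI, simp, rule measurable_compose[OF measurable_snd measurable_component_singleton])
       (use that in \<open>auto simp: I2_def\<close>)
  have y'm: "(\<lambda>z. Theta *v x' (fst z) j + \<eta>' (snd z) j) \<in> borel_measurable (S \<Otimes>\<^sub>M T)" if "j \<in> J" for j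
    by (intro borel_measurable_add borel_measurable_matrix_vector_mult x'm[OF that] \<eta>'m[OF that])
  define good where "good f \<longleftrightarrow> (\<forall>v. c * norm v \<le> design_norm J (x' f) v)" for f
  define err where "err f h = spec_norm ((\<Sum>j\<in>J. outer (Theta *v x' f j + \<eta>' h j) (x' f j)) ** pinv (\<Sum>j\<in>J. outer (x' f j) (x' f j)) - Theta)" for f h
  define H where "H = {z\<in>space (S \<Otimes>\<^sub>M T). good (fst z)} - {z\<in>space (S \<Otimes>\<^sub>M T). err (fst z) (snd z) \<le> b}"
  have "{z\<in>space (S \<Otimes>\<^sub>M T). good (fst z)} \<in> sets (S \<Otimes>\<^sub>M T)"
    unfolding good_def using design_norm_lower_measurable[of J "\<lambda>j z. x' (fst z) j", OF x'm] c by simp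
  moreover have "{z\<in>space (S \<Otimes>\<^sub>M T). err (fst z) (snd z) \<le> b} \<in> sets (S \<Otimes>\<^sub>M T)"
    unfolding err_def
    by (rule borel_measurable_least_squares_error[of J "\<lambda>j z. x' (fst z) j" _ "\<lambda>j z. Theta *v x' (fst z) j + \<eta>' (snd z) j", OF x'm y'm])
  ultimately have H: "H \<in> sets (S \<Otimes>\<^sub>M T)"
    unfolding H_def by (rule sets.Diff)
  have "emeasure M {\<omega>\<in>space M. (X \<omega>, Y \<omega>) \<in> H} \<le> ennreal \<delta>"
  proof (rule emeasure_indep_section_bound[OF XY H])
    fix \<xi> assume "\<xi> \<in> space S"
    show "emeasure M {\<omega>\<in>space M. (\<xi>, Y \<omega>) \<in> H} \<le> ennreal \<delta>"
    proof (cases "good \<xi>")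
      case False
      then show ?thesis by (simp add: H_def)
    next
      case True
      define g where "g = noise_level CARD('n) CARD('l) \<delta>"
      have "0 \<le> g" using \<delta> by (auto simp: g_def noise_level_def)
      have low: "c * norm v \<le> design_norm J (x' \<xi>) v" for v
        using True by (simp add: good_def)
      obtain A where A: "A \<in> sets M" "emeasure M A \<le> ennreal \<delta>"
        and noise: "\<And>\<omega> v. \<omega> \<in> space M - A \<Longrightarrow> norm (\<Sum>j\<in>J. (x' \<xi> j \<bullet> v) *\<^sub>R \<eta> j \<omega>) \<le> g * \<sigma> * design_norm J (x' \<xi>) v"
        using noise_bound[OF J ind\<eta> \<eta> \<sigma> c low \<open>0 \<le> g\<close>] noise_failure_probability[OF \<delta>, of "CARD('n)" "CARD('l)", folded g_def]
        by auto
      have "err \<xi> (Y \<omega>) \<le> b" if w: "\<omega> \<in> space M - A" for \<omega>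
      proof -
        have "spec_norm ((\<Sum>j\<in>J. outer (Theta *v x' \<xi> j + \<eta> j \<omega>) (x' \<xi> j)) ** pinv (\<Sum>j\<in>J. outer (x' \<xi> j) (x' \<xi> j)) - Theta) \<le> g * \<sigma> / sqrt (c\<^sup>2)"
        proof (rule least_squares_error)
          show "c\<^sup>2 * (norm z)\<^sup>2 \<le> (\<Sum>j\<in>J. (x' \<xi> j \<bullet> z)\<^sup>2)" for z
            unfolding design_norm_square[symmetric] power_mult_distrib[symmetric]
            using low[of z] c by (intro power_mono) auto
          show "norm (\<Sum>j\<in>J. (x' \<xi> j \<bullet> z) *\<^sub>R \<eta> j \<omega>) \<le> g * \<sigma> * sqrt (\<Sum>j\<in>J. (x' \<xi> j \<bullet> z)\<^sup>2)" for z
            using noise[OF w, of z] by (simp add: design_norm_def L2_set_def)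
        qed (use c \<sigma> \<open>0 \<le> g\<close> in auto)
        also have "\<dots> \<le> b" using b c by (simp add: g_def)
        finally show ?thesis by (simp add: err_def \<eta>'Y)
      qed
      then have "{\<omega>\<in>space M. (\<xi>, Y \<omega>) \<in> H} \<subseteq> A"
        by (auto simp: H_def)
      then have "emeasure M {\<omega>\<in>space M. (\<xi>, Y \<omega>) \<in> H} \<le> emeasure M A"
        using A(1) by (rule emeasure_mono)
      then show ?thesis using A(2) by simp
    qed
  qed
  moreover have "(X \<omega>, Y \<omega>) \<in> H \<longleftrightarrow> (\<forall>v. c * norm v \<le> design_norm J (\<lambda>j. x j \<omega>) v) \<and>
    \<not> spec_norm ((\<Sum>j\<in>J. outer (Theta *v x j \<omega> + \<eta> j \<omega>) (x j \<omega>)) ** pinv (\<Sum>j\<in>J. outer (x j \<omega>) (x j \<omega>)) - Theta) \<le> b"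
    if "\<omega> \<in> space M" for \<omega>
  proof -
    have "design_norm J (x' (X \<omega>)) v = design_norm J (\<lambda>j. x j \<omega>) v" for v
      by (simp add: design_norm_def L2_set_def x'X)
    moreover have "(X \<omega>, Y \<omega>) \<in> space (S \<Otimes>\<^sub>M T)"
      using measurable_space[OF Xm that] measurable_space[OF Ym that] by (simp add: space_pair_measure)
    ultimately show ?thesis
      by (simp add: H_def good_def err_def x'X \<eta>'Y)
  qed
  ultimately show ?thesis by (simp cong: conj_cong)
qed

section \<open>Assembly of the probability bound\<close>

theorem theorem1:
  fixes M :: "'w measure"
    and Theta :: "real^'n^'l"
    and x :: "nat \<Rightarrow> 'w \<Rightarrow> real^'n"
    and eta :: "nat \<Rightarrow> 'w \<Rightarrow> real^'l"
    and y :: "nat \<Rightarrow> 'w \<Rightarrow> real^'l"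
    and mu :: "nat \<Rightarrow> real^'n"
    and sigma_x sigma_eta mu_hat delta :: real
    and t :: nat
  assumes "prob_space M"
    and sx: "sigma_x > 0" and se: "sigma_eta > 0" and mh: "mu_hat \<ge> 0"
    and mu_bd: "\<And>j. j \<ge> 1 \<Longrightarrow> norm (mu j) \<le> mu_hat"
    and x_dist: "\<And>j k. j \<ge> 1 \<Longrightarrow>
          distributed M lborel (\<lambda>\<omega>. x j \<omega> $ k) (normal_density (mu j $ k) sigma_x)"
    and eta_dist: "\<And>j k. j \<ge> 1 \<Longrightarrow>
          distributed M lborel (\<lambda>\<omega>. eta j \<omega> $ k) (normal_density 0 sigma_eta)"
    and indep: "prob_space.indep_vars M (\<lambda>_. borel)
          (\<lambda>i \<omega>. case i of Inl (j, k) \<Rightarrow> x j \<omega> $ k | Inr (j, k') \<Rightarrow> eta j \<omega> $ k')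
          (({1..} \<times> UNIV) <+> ({1..} \<times> UNIV))"
    and y_def: "\<And>j \<omega>. j \<ge> 1 \<Longrightarrow> \<omega> \<in> space M \<Longrightarrow> y j \<omega> = Theta *v x j \<omega> + eta j \<omega>"
    and delta: "delta > 0"
    and t_ge: "real t \<ge> max (8 * real CARD('n) + 16 * ln (2 / delta))
                 (max ((16 * mu_hat * (sqrt (4 * real CARD('n)) + sqrt (2 * ln (2 / delta))) / sigma_x)\<^sup>2)
                      (2 * (real CARD('n) + real CARD('l)) * ln (1 / delta)))"
  shows "prob_space.prob M {\<omega> \<in> space M.
           spec_norm ((\<Sum>j = 1..t. outer (y j \<omega>) (x j \<omega>)) ** pinv (\<Sum>j = 1..t. outer (x j \<omega>) (x j \<omega>)) - Theta)
           \<le> (8 * sigma_eta * (4 * sigma_x * sqrt ((real CARD('n) + real CARD('l)) * ln (9 / delta))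
                 + mu_hat * (sqrt (2 * (real CARD('l) + real CARD('n))) + 2 * sqrt (ln (2 / delta)))))
             / (sqrt (real t) * sigma_x\<^sup>2 *
                lambda_min (mat 1 + (4 / (real t * sigma_x\<^sup>2)) *\<^sub>R (\<Sum>j = 1..t. outer (mu j) (mu j))))}
         \<ge> 1 - 4 * delta"
proof -
  interpret prob_space M by fact
  define J where "J = {1..t}"
  have J: "finite J" "\<And>j. j \<in> J \<Longrightarrow> j \<ge> 1" "card J = t" by (auto simp: J_def)
  define n l where "n = CARD('n)" and "l = CARD('l)"
  have nl: "1 \<le> n" "1 \<le> l" by (auto simp: n_def l_def Suc_le_eq)
  define bound where "bound = (8 * sigma_eta * (4 * sigma_x * sqrt ((real n + real l) * ln (9 / delta))
      + mu_hat * (sqrt (2 * (real l + real n)) + 2 * sqrt (ln (2 / delta)))))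
    / (sqrt (real t) * sigma_x\<^sup>2 * lambda_min (mat 1 + (4 / (real t * sigma_x\<^sup>2)) *\<^sub>R (\<Sum>j\<in>J. outer (mu j) (mu j))))"
  define B where "B = {\<omega>\<in>space M. spec_norm ((\<Sum>j\<in>J. outer (y j \<omega>) (x j \<omega>)) ** pinv (\<Sum>j\<in>J. outer (x j \<omega>) (x j \<omega>)) - Theta) \<le> bound}"
  have "1 - 4 * delta \<le> prob B"
  proof (cases "delta < 1/4")
    \<comment> \<open>The claimed lower bound is then at most \<open>0\<close>.\<close>
    case False
    then show ?thesis using measure_nonneg[of M B] by linarith
  next
    case True
    note d = delta True
    define L' where "L' = ln (2 / delta)"
    have "0 < L'" using d by (simp add: L'_def)
    have t1: "8 * real n + 16 * L' \<le> real t"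
      and t2: "(16 * mu_hat * (sqrt (4 * real n) + sqrt (2 * L')) / sigma_x)\<^sup>2 \<le> real t"
      using t_ge by (simp_all add: n_def L'_def)
    have t0: "0 < real t" using t1 nl \<open>0 < L'\<close> by simp
    define r where "r = mu_hat / sigma_x"
    have r: "0 \<le> r" and mur: "mu_hat = r * sigma_x" using mh sx by (auto simp: r_def)
    have mean: "norm (mu j) \<le> r * sigma_x" if "j \<in> J" for j
      using mu_bd[of j] J(2)[OF that] by (simp add: mur)
    \<comment> \<open>The dependence on \<open>r\<close> keeps
      \<open>e * (3 + r) \<le> 3 / 100\<close> whatever the size of the means.\<close>
    define e where "e = 1 / (100 * (1 + r))"
    have e: "0 < e" "e < 1" "e \<le> 1 / 100" "e * (3 + r) \<le> 3 / 100" using r by (auto simp: e_def field_simps)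
    define c where "c = 4 / (real t * sigma_x\<^sup>2)"
    define lam where "lam = lambda_min (mat 1 + c *\<^sub>R (\<Sum>j\<in>J. outer (mu j) (mu j)))"
    have c0: "0 \<le> c" by (simp add: c_def)
    note lam = lambda_min_shifted_gram[OF c0, where J = J and \<mu> = mu, folded lam_def n_def]
    have lam_r: "real n * (lam - 1) \<le> 4 * r\<^sup>2"
    proof -
      have "real n * (lam - 1) \<le> c * (\<Sum>j\<in>J. (norm (mu j))\<^sup>2)" by (rule lam(3))
      also have "\<dots> \<le> c * (\<Sum>j\<in>J. (r * sigma_x)\<^sup>2)"
        using mean c0 by (intro mult_left_mono sum_mono power_mono) auto
      also have "\<dots> = 4 * r\<^sup>2"
        using t0 sx by (simp add: c_def J(3) power_mult_distrib)
      finally show ?thesis .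
    qed
    \<comment> \<open>The factor \<open>4\<close> in \<open>c\<close> is undone:
      \<open>(lam - 1) / 4\<close> bounds the Gram matrix of the means from below in units of
      \<open>t * sigma_x\<^sup>2\<close>.\<close>
    have lam_mean: "card J * sigma_x\<^sup>2 * ((lam - 1) / 4) * (norm v)\<^sup>2 \<le> (\<Sum>j\<in>J. (mu j \<bullet> v)\<^sup>2)" for v
    proof -
      have "real t * sigma_x\<^sup>2 / 4 * ((lam - 1) * (norm v)\<^sup>2) \<le> real t * sigma_x\<^sup>2 / 4 * (c * (\<Sum>j\<in>J. (mu j \<bullet> v)\<^sup>2))"
        using lam(2)[of v] by (intro mult_left_mono) auto
      also have "\<dots> = (\<Sum>j\<in>J. (mu j \<bullet> v)\<^sup>2)" using t0 sx by (simp add: c_def)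
      finally show ?thesis by (simp add: J(3) mult_ac)
    qed
    have indJ: "indep_vars (\<lambda>_. borel) (\<lambda>i \<omega>. case i of Inl (j, k) \<Rightarrow> x j \<omega> $ k | Inr (j, k') \<Rightarrow> eta j \<omega> $ k')
        ((J \<times> UNIV) <+> (J \<times> UNIV))"
      using J(2) by (intro indep_vars_subset[OF indep]) auto
    have indx: "indep_vars (\<lambda>_. borel) (\<lambda>(j, k) \<omega>. x j \<omega> $ k) (J \<times> UNIV)"
    proof -
      have "indep_vars (\<lambda>_. borel) (\<lambda>k \<omega>. case Inl k :: (nat \<times> 'n) + (nat \<times> 'l) of Inl (j, k) \<Rightarrow> x j \<omega> $ k | Inr (j, k') \<Rightarrow> eta j \<omega> $ k') (J \<times> UNIV)"
        by (rule indep_vars_reindex_inj[OF indJ]) auto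
      then show ?thesis by (simp add: case_prod_unfold)
    qed
    have xd: "distributed M lborel (\<lambda>\<omega>. x j \<omega> $ k) (normal_density (mu j $ k) sigma_x)" if "j \<in> J" for j k
      by (rule x_dist[OF J(2)[OF that]])
    have ed: "distributed M lborel (\<lambda>\<omega>. eta j \<omega> $ k) (normal_density 0 sigma_eta)" if "j \<in> J" for j k
      by (rule eta_dist[OF J(2)[OF that]])
    have xm: "x j \<in> borel_measurable M" if "j \<in> J" for j
      using distributed_measurable[OF xd[OF that]] by (intro borel_measurable_vecI) simp
    have em: "eta j \<in> borel_measurable M" if "j \<in> J" for j
      using distributed_measurable[OF ed[OF that]] by (intro borel_measurable_vecI) simp
    have y_eq: "y j \<omega> = Theta *v x j \<omega> + eta j \<omega>" if "j \<in> J" "\<omega> \<in> space M" for j \<omega>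
      by (rule y_def[OF J(2)[OF that(1)] that(2)])
    have B_eq: "B = {\<omega>\<in>space M. spec_norm ((\<Sum>j\<in>J. outer (Theta *v x j \<omega> + eta j \<omega>) (x j \<omega>)) ** pinv (\<Sum>j\<in>J. outer (x j \<omega>) (x j \<omega>)) - Theta) \<le> bound}"
      unfolding B_def by (auto simp: y_eq)
    have Bm: "B \<in> sets M"
      unfolding B_eq
      by (intro borel_measurable_least_squares_error borel_measurable_add borel_measurable_matrix_vector_mult xm em)
    define g where "g = noise_level n l delta"
    define a where "a = sqrt ((real n + real l) * ln (9 / delta))"
    define b where "b = sqrt (2 * (real l + real n)) + 2 * sqrt (ln (2 / delta))"
    have g0: "0 \<le> g" using d by (auto simp: g_def noise_level_def)
    have ga: "g \<le> 8/3 * a" unfolding g_def a_def using d nl by (intro noise_level_le) auto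
    have gb: "g \<le> sqrt (2 * real n) * b" unfolding g_def b_def using d nl by (intro noise_level_le_mean_term) auto
    have b0: "0 \<le> b" using \<open>0 < L'\<close> by (simp add: b_def L'_def)
    have lam1: "1 \<le> lam" by (rule lam(1))
    obtain A1 where A1: "A1 \<in> sets M" "emeasure M A1 \<le> ennreal delta"
      and dev: "\<And>\<omega> v. \<omega> \<in> space M - A1 \<Longrightarrow> design_norm J (\<lambda>j. x j \<omega> - mu j) v \<le> 3 * sqrt (card J) * sigma_x * norm v"
    proof -
      have "5 ^ n * (exp (- (81/100) * card J) * 2 powr (card J / 2)) \<le> delta"
        using deviation_failure_probability[OF d, of n t] t1 by (simp add: J(3) L'_def)
      then show ?thesis
        using design_deviation_bound[OF J(1) indx xd sx] that unfolding n_def by (meson ennreal_leI order_trans)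
    qed
    \<comment> \<open>Common interface of the two regimes: \<open>\<rho>\<close> and
      \<open>m\<close> describe the lower bound on the design, and \<open>g * lam\<close> is
      compared with the constant divided by \<open>sigma_eta * sigma_x\<close>.\<close>
    have "\<exists>\<rho> m. 0 < \<rho> \<and> 0 \<le> m \<and> g * lam \<le> \<rho> * sqrt (1 + m) * (8 * (4 * a + r * b)) \<and>
      (\<exists>A2\<in>sets M. emeasure M A2 \<le> ennreal delta \<and>
        (\<forall>\<omega>\<in>space M - (A1 \<union> A2). \<forall>v. \<rho> * sqrt (real (card J) * (1 + m)) * sigma_x * norm v \<le> design_norm J (\<lambda>j. x j \<omega>) v))"
    proof (cases "r \<le> 1/2")
      case True
      have p: "((1 + e) / e) ^ CARD('n) * (exp (4 * (1/25) * card J) * (1 + 2 * 4) powr (- (card J / 2))) \<le> delta"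
        using tail_failure_probability_small_mean[OF d _ r True e_def, of n t] t1 by (simp add: J(3) L'_def n_def)
      have "\<exists>A\<in>sets M. emeasure M A \<le> ennreal delta \<and> (\<forall>\<omega>\<in>space M - A. \<forall>v0. norm v0 = 1 \<longrightarrow>
        (\<exists>v. norm (v - v0) \<le> e \<and> sqrt (1/25 * real (card J) * (1 + 0)) * sigma_x * norm v < design_norm J (\<lambda>j. x j \<omega>) v))"
        by (rule design_lower_tail[OF J(1) indx xd sx _ _ _ _ _ e(1,2) p]) (auto simp: sum_nonneg)
      then obtain A2 where A2: "A2 \<in> sets M" "emeasure M A2 \<le> ennreal delta"
        and tail: "\<And>\<omega> v0. \<omega> \<in> space M - A2 \<Longrightarrow> norm v0 = 1 \<Longrightarrow>
          \<exists>v. norm (v - v0) \<le> e \<and> sqrt (1/25 * real (card J) * (1 + 0)) * sigma_x * norm v < design_norm J (\<lambda>j. x j \<omega>) v"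
        by blast
      \<comment> \<open>\<open>1/5 * (99/100)\<close> exceeds \<open>1/6 + 3/100\<close>.\<close>
      have rho: "1/6 + e * (3 + r) \<le> sqrt (1/25) * (1 - e)"
      proof -
        have root: "sqrt (1/25) = (1/5 :: real)" by (rule real_sqrt_unique) (auto simp: power2_eq_square)
        show ?thesis unfolding root using e by simp
      qed
      have "1/6 * sqrt (real (card J) * (1 + 0)) * sigma_x * norm v \<le> design_norm J (\<lambda>j. x j \<omega>) v"
        if "\<omega> \<in> space M - (A1 \<union> A2)" for \<omega> v
        by (rule design_lower_bound[OF dev mean r sx _ _ tail rho]) (use that in auto)
      moreover have "g * lam \<le> 1/6 * sqrt (1 + 0) * (8 * (4 * a + r * b))"
        using error_bound_small_mean[OF g0 ga r True b0 nl(1) lam1 lam_r] by simp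
      ultimately show ?thesis
        using A2 by (intro exI[of _ "1/6"] exI[of _ 0] conjI bexI[of _ A2]) auto
    next
      case False
      then have r2: "1/2 \<le> r" by simp
      define m where "m = (lam - 1) / 4"
      have m: "0 \<le> m" using lam1 by (simp add: m_def)
      have "(16 * r * (sqrt (4 * real n) + sqrt (2 * ln (2 / delta))))\<^sup>2 \<le> real t"
        using t2 by (simp add: r_def L'_def)
      then have p: "((1 + e) / e) ^ CARD('n) * (exp (1/3 * (3/5) * card J) * (1 + 2 * (1/3)) powr (- (card J / 2))) \<le> delta"
        using tail_failure_probability_large_mean[OF d _ r2 e_def, of n t] by (simp add: J(3) n_def)
      have "\<exists>A\<in>sets M. emeasure M A \<le> ennreal delta \<and> (\<forall>\<omega>\<in>space M - A. \<forall>v0. norm v0 = 1 \<longrightarrow>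
        (\<exists>v. norm (v - v0) \<le> e \<and> sqrt (3/5 * real (card J) * (1 + m)) * sigma_x * norm v < design_norm J (\<lambda>j. x j \<omega>) v))"
        by (rule design_lower_tail[OF J(1) indx xd sx _ _ _ _ _ e(1,2) p]) (use m lam_mean in \<open>auto simp: m_def\<close>)
      then obtain A2 where A2: "A2 \<in> sets M" "emeasure M A2 \<le> ennreal delta"
        and tail: "\<And>\<omega> v0. \<omega> \<in> space M - A2 \<Longrightarrow> norm v0 = 1 \<Longrightarrow>
          \<exists>v. norm (v - v0) \<le> e \<and> sqrt (3/5 * real (card J) * (1 + m)) * sigma_x * norm v < design_norm J (\<lambda>j. x j \<omega>) v"
        by blast
      \<comment> \<open>\<open>77/100 * (99/100)\<close> exceeds
        \<open>71/100 + 3/100\<close>.\<close>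
      have rho: "sqrt (1/2) + e * (3 + r) \<le> sqrt (3/5) * (1 - e)"
      proof -
        have "77/100 \<le> sqrt (3/5 :: real)" by (rule real_le_rsqrt) (simp add: power2_eq_square)
        then have "77/100 * (99/100) \<le> sqrt (3/5) * (1 - e)"
          using e by (intro mult_mono) auto
        moreover have "sqrt (1/2) \<le> (71/100 :: real)" by (rule real_le_lsqrt) (auto simp: power2_eq_square)
        ultimately show ?thesis using e by simp
      qed
      have "sqrt (1/2) * sqrt (real (card J) * (1 + m)) * sigma_x * norm v \<le> design_norm J (\<lambda>j. x j \<omega>) v"
        if "\<omega> \<in> space M - (A1 \<union> A2)" for \<omega> v
        by (rule design_lower_bound[OF dev mean r sx _ m tail rho]) (use that in auto)
      moreover have "g * lam \<le> sqrt (1/2) * sqrt (1 + m) * (8 * (4 * a + r * b))"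
        unfolding m_def by (rule error_bound_large_mean[OF g0 ga gb r b0 nl(1) lam1 lam_r])
      ultimately show ?thesis
        using A2 m by (intro exI[of _ "sqrt (1/2)"] exI[of _ m] conjI bexI[of _ A2]) auto
    qed
    then obtain \<rho> m A2 where \<rho>: "0 < \<rho>" "0 \<le> m" "g * lam \<le> \<rho> * sqrt (1 + m) * (8 * (4 * a + r * b))"
      and A2: "A2 \<in> sets M" "emeasure M A2 \<le> ennreal delta"
      and low: "\<And>\<omega> v. \<omega> \<in> space M - (A1 \<union> A2) \<Longrightarrow> \<rho> * sqrt (real (card J) * (1 + m)) * sigma_x * norm v \<le> design_norm J (\<lambda>j. x j \<omega>) v"
      by blast
    define cl where "cl = \<rho> * sqrt (real (card J) * (1 + m)) * sigma_x"
    have cl: "0 < cl" using \<rho> t0 sx by (simp add: cl_def J(3))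
    have err: "noise_level CARD('n) CARD('l) delta * sigma_eta / cl \<le> bound"
    proof -
      have "bound = 8 * sigma_eta * (sigma_x * (4 * a + r * b)) / (sqrt (real t) * sigma_x\<^sup>2 * lam)"
        by (simp add: bound_def a_def b_def lam_def c_def mur algebra_simps)
      also have "\<dots> = sigma_eta * (8 * (4 * a + r * b)) / (sqrt (real t) * sigma_x * lam)"
        using sx by (simp add: power2_eq_square) (simp add: algebra_simps)
      finally have "bound = sigma_eta * (8 * (4 * a + r * b)) / (sqrt (real t) * sigma_x * lam)" .
      moreover have "g * sigma_eta / cl \<le> sigma_eta * (8 * (4 * a + r * b)) / (sqrt (real t) * sigma_x * lam)"
      proof -
        have "g * sigma_eta * (sqrt (real t) * sigma_x * lam) = (g * lam) * (sigma_eta * sqrt (real t) * sigma_x)"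
          by simp
        also have "\<dots> \<le> (\<rho> * sqrt (1 + m) * (8 * (4 * a + r * b))) * (sigma_eta * sqrt (real t) * sigma_x)"
          using \<rho>(3) se sx by (intro mult_right_mono) auto
        also have "\<dots> = sigma_eta * (8 * (4 * a + r * b)) * cl"
          by (simp add: cl_def J(3) real_sqrt_mult)
        finally show ?thesis
          using cl t0 sx lam1 by (simp add: divide_le_eq pos_le_divide_eq mult_ac)
      qed
      ultimately show ?thesis by (simp add: g_def n_def l_def)
    qed
    define C where "C = {\<omega>\<in>space M. \<forall>v. cl * norm v \<le> design_norm J (\<lambda>j. x j \<omega>) v} - B"
    have Cm: "C \<in> sets M"
      unfolding C_def using cl by (intro sets.Diff Bm design_norm_lower_measurable xm) auto
    have "C = {\<omega>\<in>space M. (\<forall>v. cl * norm v \<le> design_norm J (\<lambda>j. x j \<omega>) v) \<and>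
      \<not> spec_norm ((\<Sum>j\<in>J. outer (Theta *v x j \<omega> + eta j \<omega>) (x j \<omega>)) ** pinv (\<Sum>j\<in>J. outer (x j \<omega>) (x j \<omega>)) - Theta) \<le> bound}"
      unfolding C_def B_eq by auto
    then have "emeasure M C \<le> ennreal delta"
      using regression_error_on_good_designs[OF J(1) indJ ed se cl delta _ err] d by simp
    then have probs: "prob A1 \<le> delta" "prob A2 \<le> delta" "prob C \<le> delta"
      using A1(2) A2(2) delta by (simp_all add: emeasure_eq_measure)
    \<comment> \<open>The complement of \<open>B\<close> splits into bad designs, inside
      \<open>A1 \<union> A2\<close>, and large errors on good designs, which form \<open>C\<close>:
      three events of probability at most \<open>delta\<close> each.\<close>
    have "space M - B \<subseteq> A1 \<union> A2 \<union> C"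
      using low unfolding C_def cl_def by blast
    then have "prob (space M - B) \<le> prob (A1 \<union> A2 \<union> C)"
      using A1 A2 Cm by (intro finite_measure_mono) auto
    also have "\<dots> \<le> prob A1 + prob A2 + prob C"
      using measure_Un_le[of "A1 \<union> A2" M C] measure_Un_le[of A1 M A2] A1 A2 Cm by auto
    finally show ?thesis
      using probs prob_compl[OF Bm] delta by simp
  qed
  then show ?thesis
    unfolding B_def bound_def J_def n_def l_def .
qed

end
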